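(* Let $\Gamma<\mathrm{PSL}(2,\mathbb{R})$ be a Fuchsian group such that $\Sigma=\mathbb{H}/\Gamma$ is a closed orientable hyperbolic surface, and let $$\mathrm{Aut}(\mathrm{ax}(\Gamma)) = \{g\in \mathrm{PSL}(2,\mathbb{R}) : g(\mathrm{ax}(\Gamma)) = \mathrm{ax}(\Gamma)\}.$$ If some value in the angle spectrum of $\Sigma$ has finite multiplicity, then $\Gamma$ has finite index in $\mathrm{Aut}(\mathrm{ax}(\Gamma))$.
   Context: $\mathrm{ax}(\Gamma)$ denotes the set of all axes in the hyperbolic plane $\mathbb{H}$ of hyperbolic elements of $\Gamma$. If $\alpha,\beta$ are primitive closed geodesics on $\Sigma$ which meet (transversely) at a point $z\in\Sigma$, then $\alpha\angle_z\beta\in\,]0,\pi[$ denotes the angle at $z$ measured in the counter-clockwise direction from $\alpha$ to $\beta$. The angle spectrum of $\Sigma$ is the collection of all such angles, over all ordered pairs $(\alpha,\beta)$ and all their intersections $z$, counted with multiplicity; the multiplicity of a value $\theta$ is the number of such intersections with $\alpha\angle_z\beta=\theta$. *)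

theory Defs
  imports "HOL-Analysis.Analysis" "HOL-Algebra.Coset"
begin

section \<open>The group PSL(2,R) and its action on the upper half-plane\<close>

definition quotient_topology :: "'a topology \<Rightarrow> ('a \<Rightarrow> 'b) \<Rightarrow> 'b topology" where
  "quotient_topology X f =
     topology (\<lambda>U. U \<subseteq> f ` topspace X \<and> openin X {x \<in> topspace X. f x \<in> U})"

lemma openin_quotient_topology:
  "openin (quotient_topology X f) U \<longleftrightarrow>
     U \<subseteq> f ` topspace X \<and> openin X {x \<in> topspace X. f x \<in> U}"
proof -
  have "istopology (\<lambda>U. U \<subseteq> f ` topspace X \<and> openin X {x \<in> topspace X. f x \<in> U})"
    unfolding istopology_def
  proof (intro conjI allI impI; (elim conjE)?)
    fix S T
    assume "openin X {x \<in> topspace X. f x \<in> S}" "openin X {x \<in> topspace X. f x \<in> T}"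
    then have "openin X ({x \<in> topspace X. f x \<in> S} \<inter> {x \<in> topspace X. f x \<in> T})"
      by (rule openin_Int)
    moreover have "{x \<in> topspace X. f x \<in> S} \<inter> {x \<in> topspace X. f x \<in> T}
        = {x \<in> topspace X. f x \<in> S \<inter> T}"
      by blast
    ultimately show "openin X {x \<in> topspace X. f x \<in> S \<inter> T}" by simp
  next
    fix K
    assume K: "\<forall>U\<in>K. U \<subseteq> f ` topspace X \<and> openin X {x \<in> topspace X. f x \<in> U}"
    have "openin X (\<Union>U\<in>K. {x \<in> topspace X. f x \<in> U})"
      using K by (intro openin_Union) auto
    moreover have "(\<Union>U\<in>K. {x \<in> topspace X. f x \<in> U}) = {x \<in> topspace X. f x \<in> \<Union>K}"
      by blast
    ultimately show "openin X {x \<in> topspace X. f x \<in> \<Union>K}" by simp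
    show "\<Union>K \<subseteq> f ` topspace X" using K by blast
  qed blast
  then show ?thesis
    unfolding quotient_topology_def by (simp add: topology_inverse')
qed

definition SL2R :: "(real^2^2) monoid" where
  "SL2R = \<lparr>carrier = {A. det A = 1}, mult = (**), one = mat 1\<rparr>"

definition PSL2R :: "(real^2^2) set monoid" where
  "PSL2R = SL2R Mod {mat 1, - mat 1}"

lemma group_SL2R: "group SL2R"
proof (rule groupI)
  fix A assume "A \<in> carrier SL2R"
  then have A: "det A = 1" by (simp add: SL2R_def)
  then obtain B where B: "A ** B = mat 1" "B ** A = mat 1"
    by (metis invertible_def invertible_det_nz zero_neq_one)
  then have "det B = 1" using A by (metis det_I det_mul mult.right_neutral)
  with B show "\<exists>B\<in>carrier SL2R. B \<otimes>\<^bsub>SL2R\<^esub> A = \<one>\<^bsub>SL2R\<^esub>"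
    by (auto simp: SL2R_def)
qed (auto simp: SL2R_def det_mul matrix_mul_assoc)

lemma minus_matrix_mult:
  fixes A B :: "real^2^2"
  shows "(- A) ** B = - (A ** B)" "A ** (- B) = - (A ** B)"
  by (simp_all add: matrix_matrix_mult_def vec_eq_iff sum_negf)

lemma det_minus_2: "det (- A) = det (A :: real^2^2)"
  by (simp add: det_2)

lemma normal_pm_one: "{mat 1, - mat 1} \<lhd> SL2R"
proof -
  interpret group SL2R by (rule group_SL2R)
  have sub: "subgroup {mat 1, - mat 1} SL2R"
  proof (rule subgroupI)
    fix A :: "real^2^2" assume A: "A \<in> {mat 1, - mat 1}"
    then have "A \<otimes>\<^bsub>SL2R\<^esub> A = \<one>\<^bsub>SL2R\<^esub>" "A \<in> carrier SL2R"
      by (auto simp: SL2R_def minus_matrix_mult det_minus_2)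
    then have "inv\<^bsub>SL2R\<^esub> A = A" by (simp add: inv_equality)
    with A show "inv\<^bsub>SL2R\<^esub> A \<in> {mat 1, - mat 1}" by simp
  qed (auto simp: SL2R_def minus_matrix_mult det_minus_2)
  show ?thesis
    by (rule normalI[OF sub])
      (auto simp: r_coset_def l_coset_def SL2R_def minus_matrix_mult)
qed

lemma group_PSL2R: "group PSL2R"
  unfolding PSL2R_def by (rule normal.factorgroup_is_group[OF normal_pm_one])

definition PSL2R_topology :: "(real^2^2) set topology" where
  "PSL2R_topology =
     quotient_topology (top_of_set (carrier SL2R)) (\<lambda>A. {mat 1, - mat 1} #>\<^bsub>SL2R\<^esub> A)"

definition uhp :: "complex set" where
  "uhp = {z. Im z > 0}"

definition psl_act :: "(real^2^2) set \<Rightarrow> complex \<Rightarrow> complex" where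
  "psl_act g z = (THE w. \<exists>A\<in>g. w = moebius (complex_of_real (A$1$1)) (complex_of_real (A$1$2))
                                       (complex_of_real (A$2$1)) (complex_of_real (A$2$2)) z)"

lemma psl_act_coset:
  "psl_act ({mat 1, - mat 1} #>\<^bsub>SL2R\<^esub> A) z =
     moebius (complex_of_real (A$1$1)) (complex_of_real (A$1$2))
             (complex_of_real (A$2$1)) (complex_of_real (A$2$2)) z"
proof -
  have "{mat 1, - mat 1} #>\<^bsub>SL2R\<^esub> A = {A, - A}"
    by (auto simp: r_coset_def SL2R_def minus_matrix_mult)
  moreover have "moebius (- a) (- b) (- c) (- d) z = moebius a b c d z" for a b c d
  proof -
    have "moebius (- a) (- b) (- c) (- d) z = (- (a * z + b)) / (- (c * z + d))"
      by (simp add: moebius_def)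
    then show ?thesis by (simp only: minus_divide_divide moebius_def)
  qed
  ultimately show ?thesis
    unfolding psl_act_def by (intro the_equality) auto
qed


section \<open>Geodesics of the hyperbolic plane, axes\<close>

definition hdist :: "complex \<Rightarrow> complex \<Rightarrow> real" where
  "hdist z w = arcosh (1 + (cmod (z - w))\<^sup>2 / (2 * Im z * Im w))"

text \<open>Complete geodesics, parametrised by arc length.\<close>

definition geodesic_line :: "(real \<Rightarrow> complex) \<Rightarrow> bool" where
  "geodesic_line \<gamma> \<longleftrightarrow>
     (\<forall>t. \<gamma> t \<in> uhp) \<and> (\<forall>s t. hdist (\<gamma> s) (\<gamma> t) = \<bar>s - t\<bar>)"

definition hyperbolic_element :: "(real^2^2) set \<Rightarrow> bool" where
  "hyperbolic_element g \<longleftrightarrow> g \<in> carrier PSL2R \<and> (\<exists>A\<in>g. \<bar>trace A\<bar> > 2)"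

text \<open>A hyperbolic element leaves exactly one complete geodesic invariant.\<close>

definition axis_of :: "(real^2^2) set \<Rightarrow> complex set" where
  "axis_of g = (THE L. (\<exists>\<gamma>. geodesic_line \<gamma> \<and> L = range \<gamma>) \<and> psl_act g ` L = L)"

definition ax :: "(real^2^2) set set \<Rightarrow> complex set set" where
  "ax \<Gamma> = {axis_of g |g. g \<in> \<Gamma> \<and> hyperbolic_element g}"

definition Aut_ax :: "(real^2^2) set set \<Rightarrow> (real^2^2) set set" where
  "Aut_ax \<Gamma> = {g \<in> carrier PSL2R. (\<lambda>L. psl_act g ` L) ` ax \<Gamma> = ax \<Gamma>}"

definition has_finite_index :: "'a set \<Rightarrow> ('a, 'b) monoid_scheme \<Rightarrow> bool" where
  "has_finite_index H G \<longleftrightarrow> subgroup H G \<and> finite (rcosets\<^bsub>G\<^esub> H)"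


section \<open>Fuchsian groups and their quotient surfaces\<close>

definition fuchsian :: "(real^2^2) set set \<Rightarrow> bool" where
  "fuchsian \<Gamma> \<longleftrightarrow>
     subgroup \<Gamma> PSL2R \<and> subtopology PSL2R_topology \<Gamma> = discrete_topology \<Gamma>"

definition proj :: "(real^2^2) set set \<Rightarrow> complex \<Rightarrow> complex set" where
  "proj \<Gamma> z = (\<lambda>g. psl_act g z) ` \<Gamma>"

definition quotient_surface :: "(real^2^2) set set \<Rightarrow> complex set topology" where
  "quotient_surface \<Gamma> = quotient_topology (top_of_set uhp) (proj \<Gamma>)"

text \<open>For a Fuchsian group, freeness of the action says that the quotient is a hyperbolic
  surface without cone points, with the projection from the half-plane a covering and a local
  isometry. The quotient is connected, without boundary, and oriented by the half-plane, because
  PSL(2,R) preserves orientation; so closed only adds compactness.\<close>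

definition closed_hyperbolic_surface :: "(real^2^2) set set \<Rightarrow> bool" where
  "closed_hyperbolic_surface \<Gamma> \<longleftrightarrow>
     (\<forall>g\<in>\<Gamma>. \<forall>z\<in>uhp. psl_act g z = z \<longrightarrow> g = \<one>\<^bsub>PSL2R\<^esub>) \<and>
     compact_space (quotient_surface \<Gamma>)"


section \<open>Closed geodesics and the angle spectrum\<close>

text \<open>As the projection is a Riemannian covering, the complete unit-speed geodesics of the
  surface are the projections of geodesic lines. A closed geodesic is such a curve together with
  a length (a period); it is primitive if it is not a shorter closed geodesic traversed several
  times.\<close>

definition closed_geodesic :: "(real^2^2) set set \<Rightarrow> (real \<Rightarrow> complex set) \<Rightarrow> real \<Rightarrow> bool" where
  "closed_geodesic \<Gamma> c l \<longleftrightarrow>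
     (\<exists>\<gamma>. geodesic_line \<gamma> \<and> c = (\<lambda>t. proj \<Gamma> (\<gamma> t))) \<and> l > 0 \<and> (\<forall>t. c (t + l) = c t)"

definition primitive_closed_geodesic ::
  "(real^2^2) set set \<Rightarrow> (real \<Rightarrow> complex set) \<Rightarrow> real \<Rightarrow> bool" where
  "primitive_closed_geodesic \<Gamma> c l \<longleftrightarrow>
     closed_geodesic \<Gamma> c l \<and> \<not> (\<exists>n::nat. n \<ge> 2 \<and> closed_geodesic \<Gamma> c (l / real n))"

text \<open>Closed geodesics are unoriented and have no base point: a geodesic is represented by the
  set of all its unit-speed parametrisations.\<close>

definition parametrisations :: "(real \<Rightarrow> 'a) \<Rightarrow> (real \<Rightarrow> 'a) set" where
  "parametrisations c = {(\<lambda>t. c (e * t + s)) |e s. e \<in> {1, -1}}"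

definition primitive_closed_geodesics :: "(real^2^2) set set \<Rightarrow> (real \<Rightarrow> complex set) set set" where
  "primitive_closed_geodesics \<Gamma> =
     {parametrisations c |c. \<exists>l. primitive_closed_geodesic \<Gamma> c l}"

text \<open>\<open>meets_at_angle \<Gamma> \<alpha> \<beta> z \<theta>\<close>: the geodesics \<open>\<alpha>\<close> and \<open>\<beta>\<close> have branches through \<open>z\<close> such
  that the counter-clockwise angle from that of \<open>\<alpha>\<close> to that of \<open>\<beta>\<close> is \<open>\<theta>\<close>. It is measured in the
  half-plane, on lifts through a common point over \<open>z\<close>; the hyperbolic metric is conformal to
  the Euclidean one, and unit-speed curves through the same point have the same Euclidean speed
  there. As \<open>\<alpha>\<close> and \<open>\<beta>\<close> contain both orientations, one gets for each pair of transverse branches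
  exactly one \<open>\<theta>\<close> between 0 and \<open>pi\<close>.\<close>

definition meets_at_angle ::
  "(real^2^2) set set \<Rightarrow> (real \<Rightarrow> complex set) set \<Rightarrow> (real \<Rightarrow> complex set) set
     \<Rightarrow> complex set \<Rightarrow> real \<Rightarrow> bool" where
  "meets_at_angle \<Gamma> \<alpha> \<beta> z \<theta> \<longleftrightarrow> 0 < \<theta> \<and> \<theta> < pi \<and>
     (\<exists>\<gamma> \<delta>. geodesic_line \<gamma> \<and> geodesic_line \<delta> \<and>
        (\<lambda>t. proj \<Gamma> (\<gamma> t)) \<in> \<alpha> \<and> (\<lambda>t. proj \<Gamma> (\<delta> t)) \<in> \<beta> \<and>
        \<gamma> 0 = \<delta> 0 \<and> proj \<Gamma> (\<gamma> 0) = z \<and>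
        vector_derivative \<delta> (at 0) = cis \<theta> * vector_derivative \<gamma> (at 0))"

text \<open>The pairs are ordered, and \<open>\<alpha> = \<beta>\<close> (a self-intersection) is allowed. Only finitely many
  branches of a closed geodesic pass through a given point, so whether a multiplicity is finite
  does not depend on counting intersection points or pairs of branches.\<close>

definition intersections_at_angle ::
  "(real^2^2) set set \<Rightarrow> real \<Rightarrow>
     ((real \<Rightarrow> complex set) set \<times> (real \<Rightarrow> complex set) set \<times> complex set) set" where
  "intersections_at_angle \<Gamma> \<theta> =
     {(\<alpha>, \<beta>, z). \<alpha> \<in> primitive_closed_geodesics \<Gamma> \<and> \<beta> \<in> primitive_closed_geodesics \<Gamma> \<and>
        meets_at_angle \<Gamma> \<alpha> \<beta> z \<theta>}"

definition angle_spectrum :: "(real^2^2) set set \<Rightarrow> real set" where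
  "angle_spectrum \<Gamma> = {\<theta>. intersections_at_angle \<Gamma> \<theta> \<noteq> {}}"

definition angle_multiplicity :: "(real^2^2) set set \<Rightarrow> real \<Rightarrow> enat" where
  "angle_multiplicity \<Gamma> \<theta> =
     (if finite (intersections_at_angle \<Gamma> \<theta>) then enat (card (intersections_at_angle \<Gamma> \<theta>)) else \<infinity>)"

end

theory Submission
  imports Defs
begin

text \<open>Take two axes \<open>\<gamma>\<close>, \<open>\<delta>\<close> crossing at \<open>\<gamma> 0\<close> with an angle of finite multiplicity. An
  automorphism \<open>g\<close> of \<open>ax \<Gamma>\<close> carries them to two axes crossing at the same angle, so the closed
  geodesic covered by \<open>g \<circ> \<gamma>\<close> and the projection of \<open>g (\<gamma> 0)\<close> take only finitely many values. If
  these are prescribed, \<open>g\<close> can be multiplied by an element of \<open>\<Gamma>\<close> so that \<open>g (\<gamma> 0)\<close> is a fixed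
  point \<open>w\<close>; then, with \<open>l\<close> a period of the closed geodesic, \<open>g (\<gamma> l)\<close> is one of the finitely
  many points of the orbit of \<open>w\<close> at distance \<open>l\<close> from \<open>w\<close>, and these two points determine \<open>g\<close>.\<close>

section \<open>The action of PSL(2,R) in coordinates\<close>

text \<open>An element \<open>g\<close> of \<open>Aut_ax \<Gamma>\<close> need not normalise
  \<Gamma>, so it need not induce a map of the surface. What it does respect is the family of lifts
  of closed geodesics, which are exactly the axes, and, being holomorphic on the half-plane, the
  oriented angle between two of them. The lengths of closed geodesics may change, however: the
  period \<open>l\<close> is that of the prescribed image geodesic, so that one \<open>l\<close>
  serves all \<open>g\<close> under consideration. Left multiplication by \<Gamma> changes neither
  the coset of \<open>g\<close> nor the projections. Two points determine \<open>g\<close> because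
  elements of \<open>PSL2R\<close> preserve orientation, which excludes the reflection in the line
  through them. Finiteness of the orbit points at a bounded distance is proper discontinuity, which
  has to be extracted from discreteness in a quotient topology on matrices. Since
  \<open>axis_of\<close> is a definite description, both existence and uniqueness of the invariant
  line are required; conjugation moves these questions to the imaginary axis.\<close>

definition mat2 :: "real \<Rightarrow> real \<Rightarrow> real \<Rightarrow> real \<Rightarrow> real^2^2" where
  "mat2 a b c d = vector [vector [a, b], vector [c, d]]"

lemma mat2_nth [simp]:
  "mat2 a b c d $ 1 $ 1 = a" "mat2 a b c d $ 1 $ 2 = b"
  "mat2 a b c d $ 2 $ 1 = c" "mat2 a b c d $ 2 $ 2 = d"
  by (simp_all add: mat2_def)

lemma det_mat2 [simp]: "det (mat2 a b c d) = a * d - b * c"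
  by (simp add: det_2)

lemma trace_mat2 [simp]: "trace (mat2 a b c d) = a + d"
  by (simp add: trace_def sum_2)

lemma mat2_eta: "A = mat2 (A$1$1) (A$1$2) (A$2$1) (A$2$2)"
  by (simp add: vec_eq_iff forall_2)

lemma mat2_mult:
  "mat2 a b c d ** mat2 a' b' c' d' =
     mat2 (a*a' + b*c') (a*b' + b*d') (c*a' + d*c') (c*b' + d*d')"
  by (simp add: vec_eq_iff forall_2 matrix_matrix_mult_def sum_2)

lemma uminus_mat2: "- mat2 a b c d = mat2 (-a) (-b) (-c) (-d)"
  by (simp add: vec_eq_iff forall_2)

lemma mat_1_mat2: "(mat 1 :: real^2^2) = mat2 1 0 0 1"
  by (simp add: vec_eq_iff forall_2 mat_def)

definition psl :: "real \<Rightarrow> real \<Rightarrow> real \<Rightarrow> real \<Rightarrow> (real^2^2) set" where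
  "psl a b c d = {mat 1, - mat 1} #>\<^bsub>SL2R\<^esub> mat2 a b c d"

lemma psl_eq: "psl a b c d = {mat2 a b c d, mat2 (-a) (-b) (-c) (-d)}"
  by (auto simp: psl_def r_coset_def SL2R_def minus_matrix_mult uminus_mat2)

lemma psl_uminus: "psl (-a) (-b) (-c) (-d) = psl a b c d"
  by (auto simp: psl_eq)

lemma psl_in_carrier [simp]: "a*d - b*c = 1 \<Longrightarrow> psl a b c d \<in> carrier PSL2R"
  unfolding PSL2R_def FactGroup_def RCOSETS_def psl_def
  by (auto simp: SL2R_def intro!: exI[of _ "mat2 a b c d"])

lemma PSL2R_cases:
  assumes "g \<in> carrier PSL2R"
  obtains a b c d where "g = psl a b c d" "a*d - b*c = 1"
proof -
  from assms obtain A where A: "det A = 1" "g = {mat 1, - mat 1} #>\<^bsub>SL2R\<^esub> A"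
    unfolding PSL2R_def FactGroup_def RCOSETS_def by (auto simp: SL2R_def)
  show thesis
    using that[of "A$1$1" "A$1$2" "A$2$1" "A$2$2"] A mat2_eta[of A]
    by (simp add: psl_def det_2 flip: mat2_eta)
qed

lemma psl_mult:
  assumes "a*d - b*c = 1" "a'*d' - b'*c' = 1"
  shows "psl a b c d \<otimes>\<^bsub>PSL2R\<^esub> psl a' b' c' d' =
     psl (a*a' + b*c') (a*b' + b*d') (c*a' + d*c') (c*b' + d*d')"
  using normal.rcos_sum[OF normal_pm_one, of "mat2 a b c d" "mat2 a' b' c' d'"] assms
  by (simp add: PSL2R_def FactGroup_def psl_def mat2_mult[symmetric])
    (simp add: SL2R_def)

lemma one_PSL2R: "\<one>\<^bsub>PSL2R\<^esub> = psl 1 0 0 1"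
  by (auto simp: PSL2R_def FactGroup_def psl_eq mat_1_mat2 uminus_mat2)

interpretation PSL2R: group PSL2R
  by (rule group_PSL2R)

lemma psl_act_psl:
  "psl_act (psl a b c d) z = (of_real a * z + of_real b) / (of_real c * z + of_real d)"
  by (simp add: psl_def psl_act_coset moebius_def)

lemma psl_denom_nonzero:
  assumes "a*d - b*c = 1" "z \<in> uhp"
  shows "of_real c * z + of_real d \<noteq> 0"
proof
  assume "of_real c * z + of_real d = 0"
  then have "c * Im z = 0" "c * Re z + d = 0"
    by (auto simp: complex_eq_iff)
  then show False using assms by (auto simp: uhp_def)
qed

lemma psl_act_one [simp]: "psl_act \<one>\<^bsub>PSL2R\<^esub> z = z"
  by (simp add: one_PSL2R psl_act_psl)

lemma Im_psl_act_psl: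
  assumes "a*d - b*c = 1"
  shows "Im (psl_act (psl a b c d) z) = Im z / (cmod (of_real c * z + of_real d))\<^sup>2"
proof -
  have "Im (psl_act (psl a b c d) z)
      = (a*d - b*c) * Im z / ((c * Re z + d)\<^sup>2 + (c * Im z)\<^sup>2)"
    by (simp add: psl_act_psl Im_divide algebra_simps)
  then show ?thesis
    using assms by (simp add: cmod_power2)
qed

lemma psl_act_uhp [simp]:
  assumes "g \<in> carrier PSL2R" "z \<in> uhp"
  shows "psl_act g z \<in> uhp"
proof -
  obtain a b c d where g: "g = psl a b c d" "a*d - b*c = 1"
    by (rule PSL2R_cases[OF assms(1)])
  then show ?thesis
    using psl_denom_nonzero[OF g(2) assms(2)] assms(2)
    by (simp add: uhp_def Im_psl_act_psl)
qed

lemma psl_act_mult: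
  assumes "g \<in> carrier PSL2R" "h \<in> carrier PSL2R" "z \<in> uhp"
  shows "psl_act (g \<otimes>\<^bsub>PSL2R\<^esub> h) z = psl_act g (psl_act h z)"
proof -
  obtain a b c d where g: "g = psl a b c d" "a*d - b*c = 1"
    by (rule PSL2R_cases[OF assms(1)])
  obtain a' b' c' d' where h: "h = psl a' b' c' d'" "a'*d' - b'*c' = 1"
    by (rule PSL2R_cases[OF assms(2)])
  let ?q = "of_real c' * z + of_real d'"
  have q: "?q \<noteq> 0" by (rule psl_denom_nonzero[OF h(2) assms(3)])
  let ?p = "of_real a' * z + of_real b'"
  have "psl_act g (psl_act h z) =
     (of_real a * (?p / ?q) + of_real b) / (of_real c * (?p / ?q) + of_real d)"
    by (simp add: g h psl_act_psl)
  also have "\<dots> = ((of_real a * (?p / ?q) + of_real b) * ?q) / ((of_real c * (?p / ?q) + of_real d) * ?q)"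
    using q by simp
  also have "\<dots> = (of_real a * ?p + of_real b * ?q) / (of_real c * ?p + of_real d * ?q)"
    using q by (simp add: distrib_right)
  also have "\<dots> = psl_act (g \<otimes>\<^bsub>PSL2R\<^esub> h) z"
    using g h by (simp add: psl_mult psl_act_psl algebra_simps)
  finally show ?thesis ..
qed

lemma psl_act_inv [simp]:
  assumes "g \<in> carrier PSL2R" "z \<in> uhp"
  shows "psl_act (inv\<^bsub>PSL2R\<^esub> g) (psl_act g z) = z"
    and "psl_act g (psl_act (inv\<^bsub>PSL2R\<^esub> g) z) = z"
  using assms by (simp_all flip: psl_act_mult)

lemma inj_on_psl_act: "g \<in> carrier PSL2R \<Longrightarrow> inj_on (psl_act g) uhp"
  by (rule inj_on_inverseI[where g = "psl_act (inv\<^bsub>PSL2R\<^esub> g)"]) simp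

text \<open>With \<open>?p\<close> and \<open>?q\<close> the denominators at \<open>z\<close> and
  \<open>w\<close>, the difference of the images is \<open>(z - w) / (?p * ?q)\<close>, while the
  two heights are divided by the squared moduli of \<open>?p\<close> and \<open>?q\<close>. These
  factors cancel in the quotient that defines \<open>hdist\<close>.\<close>

lemma hdist_psl_act [simp]:
  assumes "g \<in> carrier PSL2R" "z \<in> uhp" "w \<in> uhp"
  shows "hdist (psl_act g z) (psl_act g w) = hdist z w"
proof -
  obtain a b c d where g: "g = psl a b c d" "a*d - b*c = 1"
    by (rule PSL2R_cases[OF assms(1)])
  let ?p = "of_real c * z + of_real d" and ?q = "of_real c * w + of_real d"
  have nz: "?p \<noteq> 0" "?q \<noteq> 0"
    using psl_denom_nonzero[OF g(2)] assms by auto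
  have "psl_act g z - psl_act g w = of_real (a*d - b*c) * (z - w) / (?p * ?q)"
    using nz by (simp add: g(1) psl_act_psl diff_frac_eq) (simp add: algebra_simps)
  then have "cmod (psl_act g z - psl_act g w) = cmod (z - w) / (cmod ?p * cmod ?q)"
    using g(2) by (simp add: norm_divide norm_mult)
  moreover have "Im (psl_act g z) = Im z / (cmod ?p)\<^sup>2" "Im (psl_act g w) = Im w / (cmod ?q)\<^sup>2"
    using g by (simp_all add: Im_psl_act_psl)
  ultimately show ?thesis
    using nz by (simp add: hdist_def power_mult_distrib power_divide)
qed

lemma cosh_hdist:
  assumes "z \<in> uhp" "w \<in> uhp"
  shows "cosh (hdist z w) = 1 + (cmod (z - w))\<^sup>2 / (2 * Im z * Im w)"
  using assms unfolding hdist_def by (intro cosh_arcosh_real) (auto simp: uhp_def)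

lemma hdist_nonneg: "z \<in> uhp \<Longrightarrow> w \<in> uhp \<Longrightarrow> hdist z w \<ge> 0"
  unfolding hdist_def by (intro arcosh_nonneg_real) (auto simp: uhp_def)

lemma hdist_self [simp]: "hdist z z = 0"
  by (simp add: hdist_def)

lemma cmod_diff_power2_hdist:
  assumes "z \<in> uhp" "w \<in> uhp"
  shows "(cmod (z - w))\<^sup>2 = 2 * Im z * Im w * (cosh (hdist z w) - 1)"
  using assms by (auto simp: cosh_hdist uhp_def)


section \<open>Geodesic lines\<close>

text \<open>The model geodesic, to which every other one is moved: the imaginary axis, parametrised
  upwards by arc length with \<open>vline 0\<close> at the point i.\<close>

definition vline :: "real \<Rightarrow> complex" where
  "vline t = Complex 0 (exp t)"

lemma vline_uhp [simp]: "vline t \<in> uhp"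
  by (simp add: vline_def uhp_def)

text \<open>This is z \<mapsto> e^l z, the translation along the imaginary axis by the signed
  distance \<open>l\<close>; the exponents are halved to make the determinant 1.\<close>

definition dil :: "real \<Rightarrow> (real^2^2) set" where
  "dil l = psl (exp (l/2)) 0 0 (exp (-l/2))"

text \<open>This is z \<mapsto> -1/z, the half-turn about i, which reverses the model
  geodesic.\<close>

definition flip :: "(real^2^2) set" where
  "flip = psl 0 (-1) 1 0"

lemma dil_carrier [simp]: "dil l \<in> carrier PSL2R"
  unfolding dil_def by (rule psl_in_carrier) (simp flip: exp_add)

lemma flip_carrier [simp]: "flip \<in> carrier PSL2R"
  unfolding flip_def by (rule psl_in_carrier) simp

lemma dil_vline: "psl_act (dil l) (vline t) = vline (t + l)"
proof -
  have "exp (l/2) = exp l * exp (- (l/2))"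
    by (simp flip: exp_add)
  then show ?thesis
    by (simp add: dil_def psl_act_psl vline_def complex_eq_iff exp_add)
qed

lemma flip_vline: "psl_act flip (vline t) = vline (-t)"
  by (simp add: flip_def psl_act_psl vline_def complex_eq_iff exp_minus Re_divide Im_divide
      power2_eq_square divide_simps)

lemma cosh_hdist_vline:
  assumes "z \<in> uhp"
  shows "(Re z)\<^sup>2 + (Im z)\<^sup>2 + exp (2*a) = 2 * Im z * exp a * cosh (hdist z (vline a))"
proof -
  have "(cmod (z - vline a))\<^sup>2 = (Re z)\<^sup>2 + (Im z - exp a)\<^sup>2"
    by (simp add: cmod_power2 vline_def)
  moreover have "exp (2*a) = (exp a)\<^sup>2" by (rule exp_double)
  moreover have "Im (vline a) = exp a" by (simp add: vline_def)
  ultimately show ?thesis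
    using cmod_diff_power2_hdist[OF assms vline_uhp[of a]]
    by (simp add: power2_diff algebra_simps)
qed

lemma cosh_diff_exp: "2 * exp a * cosh (t - a :: real) = exp t + exp (2*a) * exp (-t)"
proof -
  have "exp a * exp (t - a) = exp t" "exp a * exp (- (t - a)) = exp (2*a) * exp (-t)"
    by (simp_all flip: exp_add)
  then show ?thesis
    by (simp add: cosh_field_def algebra_simps)
qed

text \<open>For each of the two given points, the distance condition is a linear equation between
  |z|^2 and \<open>Im z\<close>. Subtracting the equations eliminates |z|^2 and yields
  \<open>Im z = exp t\<close>; substituting back leaves \<open>Re z = 0\<close>. This rigidity is
  what makes two points determine a parametrised geodesic.\<close>

lemma vline_eqI:
  assumes z: "z \<in> uhp" and "a \<noteq> b"
    and "hdist z (vline a) = \<bar>t - a\<bar>" "hdist z (vline b) = \<bar>t - b\<bar>"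
  shows "z = vline t"
proof -
  have *: "(Re z)\<^sup>2 + (Im z)\<^sup>2 + exp (2*u) = Im z * (exp t + exp (2*u) * exp (-t))"
    if "hdist z (vline u) = \<bar>t - u\<bar>" for u
    using cosh_hdist_vline[OF z, of u] cosh_diff_exp[of u t] that by (simp add: algebra_simps)
  note a = *[OF assms(3)] and b = *[OF assms(4)]
  have "(exp (2*a) - exp (2*b)) * (1 - Im z * exp (-t)) = 0"
    using a b by algebra
  moreover have "exp (2*a) \<noteq> exp (2*b)"
    using \<open>a \<noteq> b\<close> by simp
  ultimately have "Im z * exp (-t) = 1" by simp
  then have y: "Im z = exp t"
    by (simp add: exp_minus field_simps)
  have "exp t * exp (-t) = 1" by (simp flip: exp_add)
  then have "(Re z)\<^sup>2 = 0"
    using a unfolding y by algebra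
  with y show ?thesis by (simp add: vline_def complex_eq_iff)
qed

lemma geodesic_line_uhp [simp]: "geodesic_line \<gamma> \<Longrightarrow> \<gamma> t \<in> uhp"
  by (simp add: geodesic_line_def)

lemma hdist_geodesic_line: "geodesic_line \<gamma> \<Longrightarrow> hdist (\<gamma> s) (\<gamma> t) = \<bar>s - t\<bar>"
  by (simp add: geodesic_line_def)

lemma hdist_vline: "hdist (vline s) (vline t) = \<bar>s - t\<bar>"
proof -
  have "exp (2 * s) + exp (2*t) = 2 * exp s * exp t * cosh (hdist (vline s) (vline t))"
    using cosh_hdist_vline[OF vline_uhp[of s], of t] by (simp add: vline_def exp_double)
  moreover have "exp (2 * s) + exp (2*t) = 2 * exp s * exp t * cosh (s - t)"
  proof -
    have "exp t * exp (2 * s) * exp (- t) = exp (2 * s)" "exp t * exp t = exp (2 * t)"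
      by (simp_all flip: exp_add)
    moreover have "2 * exp s * cosh (s - t) = exp t + exp (2 * s) * exp (-t)"
      using cosh_diff_exp[of s t] by (metis cosh_minus minus_diff_eq)
    then have "exp t * (2 * exp s * cosh (s - t)) = exp t * (exp t + exp (2 * s) * exp (-t))"
      by (rule arg_cong)
    ultimately show ?thesis
      by (simp add: algebra_simps)
  qed
  ultimately have "cosh (hdist (vline s) (vline t)) = cosh \<bar>s - t\<bar>" by simp
  then show ?thesis
    by (metis abs_ge_zero abs_of_nonneg cosh_real_abs arcosh_cosh_real hdist_nonneg vline_uhp)
qed

lemma geodesic_line_vline: "geodesic_line vline"
  by (simp add: geodesic_line_def hdist_vline)

lemma geodesic_line_psl_act:
  "g \<in> carrier PSL2R \<Longrightarrow> geodesic_line \<gamma> \<Longrightarrow> geodesic_line (\<lambda>t. psl_act g (\<gamma> t))"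
  by (simp add: geodesic_line_def)

lemma geodesic_line_reparam:
  assumes "geodesic_line \<gamma>" "\<bar>e\<bar> = 1"
  shows "geodesic_line (\<lambda>t. \<gamma> (e * t + s))"
proof -
  have "\<bar>e * u + s - (e * t + s)\<bar> = \<bar>u - t\<bar>" for u t
    using assms(2) by (simp add: abs_mult flip: right_diff_distrib)
  then show ?thesis using assms(1) by (simp add: geodesic_line_def)
qed

text \<open>Two points on a common vertical can be translated there; otherwise they lie on a half
  circle with centre \<open>c\<close> and radius \<open>r\<close>, whose end points \<open>c - r\<close> and \<open>c + r\<close> are sent to
  \<open>0\<close> and \<open>\<infinity>\<close>.\<close>

lemma obtain_psl_act_vline:
  assumes "z \<in> uhp" "w \<in> uhp"
  obtains g s t where "g \<in> carrier PSL2R" "psl_act g z = vline s" "psl_act g w = vline t"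
proof -
  have vl: "\<exists>s. u = vline s" if "u \<in> uhp" "Re u = 0" for u
    using that by (intro exI[of _ "ln (Im u)"]) (simp add: uhp_def vline_def complex_eq_iff)
  have "\<exists>g\<in>carrier PSL2R. Re (psl_act g z) = 0 \<and> Re (psl_act g w) = 0"
  proof (cases "Re z = Re w")
    case True
    then show ?thesis
      by (intro bexI[of _ "psl 1 (- Re z) 0 1"]) (auto simp: psl_act_psl)
  next
    case False
    define c where "c = ((cmod z)\<^sup>2 - (cmod w)\<^sup>2) / (2 * (Re z - Re w))"
    define r where "r = cmod (z - of_real c)"
    have zr: "(Re z - c)\<^sup>2 + (Im z)\<^sup>2 = r\<^sup>2"
      by (simp add: r_def cmod_power2)
    have "2 * c * (Re z - Re w) = (cmod z)\<^sup>2 - (cmod w)\<^sup>2"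
      using False by (simp add: c_def divide_simps) (simp add: algebra_simps)
    then have wr: "(Re w - c)\<^sup>2 + (Im w)\<^sup>2 = r\<^sup>2"
      using zr unfolding cmod_power2 by algebra
    have "r > 0"
      using assms by (auto simp: r_def uhp_def complex_eq_iff)
    \<comment> \<open>The matrix with rows (1, r - c) and (-1, r + c), which vanishes at c - r and
      has its pole at c + r, has determinant 2r; the factor \<open>k\<close> normalises it.\<close>
    define k where "k = 1 / sqrt (2 * r)"
    have k2: "k * k * (2 * r) = 1"
      using \<open>r > 0\<close> by (simp add: k_def)
    define g where "g = psl k (k * (r - c)) (-k) (k * (r + c))"
    have g: "g \<in> carrier PSL2R"
      unfolding g_def by (rule psl_in_carrier) (use k2 in \<open>simp add: algebra_simps\<close>)
    have "Re (psl_act g u) = 0" if u: "(Re u - c)\<^sup>2 + (Im u)\<^sup>2 = r\<^sup>2" for u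
    proof -
      have "(k * Re u + k * (r - c)) * (- k * Re u + k * (r + c)) + (k * Im u) * (- k * Im u)
         = k * k * (r\<^sup>2 - ((Re u - c)\<^sup>2 + (Im u)\<^sup>2))"
        by algebra
      then show ?thesis
        using u by (simp add: g_def psl_act_psl Re_divide)
    qed
    with g zr wr show ?thesis by blast
  qed
  then show thesis
    using that vl assms by (metis psl_act_uhp)
qed

lemma geodesic_line_eq_vline:
  assumes "geodesic_line \<gamma>" "a \<noteq> b" "\<gamma> a = vline a" "\<gamma> b = vline b"
  shows "\<gamma> = vline"
proof
  fix t show "\<gamma> t = vline t"
    using vline_eqI[of "\<gamma> t" a b t] assms by (metis geodesic_line_uhp hdist_geodesic_line)
qed

text \<open>Once the points at parameters 0 and 1 lie on the imaginary axis, \<open>dil\<close>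
  moves the first to i, and \<open>flip\<close> turns the second upwards if it lies below. Rigidity
  then identifies the whole curve with \<open>vline\<close>. Statements about arbitrary lines are
  thereby reduced to the model.\<close>

lemma geodesic_line_cases:
  assumes \<gamma>: "geodesic_line \<gamma>"
  obtains g where "g \<in> carrier PSL2R" "\<gamma> = (\<lambda>t. psl_act g (vline t))"
proof -
  obtain g s s' where g: "g \<in> carrier PSL2R"
    and s: "psl_act g (\<gamma> 0) = vline s" and s': "psl_act g (\<gamma> 1) = vline s'"
    using obtain_psl_act_vline[of "\<gamma> 0" "\<gamma> 1"] \<gamma> by (metis geodesic_line_uhp)
  have "\<bar>s - s'\<bar> = 1"
    using hdist_psl_act[OF g, of "\<gamma> 0" "\<gamma> 1"] \<gamma> 
    by (simp add: s s' hdist_vline hdist_geodesic_line)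
  then consider "s' = s + 1" | "s' = s - 1" by linarith
  then have "\<exists>h\<in>carrier PSL2R. psl_act h (\<gamma> 0) = vline 0 \<and> psl_act h (\<gamma> 1) = vline 1"
  proof cases
    case 1
    then show ?thesis
      using g \<gamma> s s' by (intro bexI[of _ "dil (-s) \<otimes>\<^bsub>PSL2R\<^esub> g"])
        (simp_all add: psl_act_mult dil_vline)
  next
    case 2
    then show ?thesis
      using g \<gamma> s s' by (intro bexI[of _ "flip \<otimes>\<^bsub>PSL2R\<^esub> (dil (-s) \<otimes>\<^bsub>PSL2R\<^esub> g)"])
        (simp_all add: psl_act_mult dil_vline flip_vline)
  qed
  then obtain h where h: "h \<in> carrier PSL2R"
    "psl_act h (\<gamma> 0) = vline 0" "psl_act h (\<gamma> 1) = vline 1" by blast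
  have "(\<lambda>t. psl_act h (\<gamma> t)) = vline"
    by (rule geodesic_line_eq_vline[of _ 0 1]) (use h \<gamma> in \<open>auto intro: geodesic_line_psl_act\<close>)
  then have "\<gamma> = (\<lambda>t. psl_act (inv\<^bsub>PSL2R\<^esub> h) (vline t))"
    using psl_act_inv(1)[OF h(1) geodesic_line_uhp[OF \<gamma>]] by (metis (no_types))
  then show thesis using that h(1) by blast
qed

lemma geodesic_line_eqI:
  assumes "geodesic_line \<gamma>" "geodesic_line \<delta>" "a \<noteq> b" "\<gamma> a = \<delta> a" "\<gamma> b = \<delta> b"
  shows "\<gamma> = \<delta>"
proof -
  obtain g where g: "g \<in> carrier PSL2R" "\<delta> = (\<lambda>t. psl_act g (vline t))"
    by (rule geodesic_line_cases[OF assms(2)])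
  have "(\<lambda>t. psl_act (inv\<^bsub>PSL2R\<^esub> g) (\<gamma> t)) = vline"
    by (rule geodesic_line_eq_vline[of _ a b])
      (use g assms in \<open>auto intro: geodesic_line_psl_act\<close>)
  then have "\<gamma> t = psl_act g (vline t)" for t
    using psl_act_inv(2)[OF g(1) geodesic_line_uhp[OF assms(1)]] by metis
  then show ?thesis using g by auto
qed

lemma psl_act_vline_eq_one:
  assumes "g \<in> carrier PSL2R" "\<And>t. psl_act g (vline t) = vline t"
  shows "g = \<one>\<^bsub>PSL2R\<^esub>"
proof -
  obtain a b c d where g: "g = psl a b c d" "a*d - b*c = 1"
    by (rule PSL2R_cases[OF assms(1)])
  \<comment> \<open>Clearing the denominator in the fixed point equation at \<open>vline t\<close>
    and separating real and imaginary parts. As \<open>b\<close> and \<open>c\<close> do not depend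
    on \<open>t\<close>, two parameters force \<open>c = 0\<close>.\<close>
  have *: "b = - c * (exp t)\<^sup>2 \<and> a = d" for t
  proof -
    let ?q = "of_real c * vline t + of_real d"
    have "?q \<noteq> 0" by (rule psl_denom_nonzero[OF g(2) vline_uhp])
    moreover have "(of_real a * vline t + of_real b) / ?q = vline t"
      using assms(2)[of t] by (simp add: g psl_act_psl)
    ultimately have "of_real a * vline t + of_real b = vline t * ?q"
      by (simp add: field_simps)
    then show ?thesis
      by (simp add: vline_def complex_eq_iff power2_eq_square)
  qed
  have "c * ((exp 1)\<^sup>2 - (exp 0)\<^sup>2) = 0"
    using *[of 0] *[of 1] by (simp add: algebra_simps)
  moreover have "(exp 1)\<^sup>2 - (exp 0)\<^sup>2 \<noteq> (0::real)"
    by (simp flip: exp_double)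
  ultimately have "c = 0" by simp
  then have "b = 0" "a = d" "a * a = 1" using *[of 0] g(2) by auto
  then have "a = 1 \<or> a = -1" by (simp add: square_eq_1_iff)
  then show ?thesis
    using psl_uminus[of 1 0 0 1] \<open>c = 0\<close> \<open>b = 0\<close> \<open>a = d\<close> g by (auto simp: one_PSL2R)
qed

text \<open>Agreement at two points of a line spreads to the whole line, because a geodesic is
  determined by two of its points. The quotient of \<open>g\<close> and \<open>h\<close>, conjugated
  to the imaginary axis, then fixes that axis pointwise, and in \<open>PSL2R\<close> only the
  identity does so.\<close>

lemma psl_act_eqI:
  assumes gh: "g \<in> carrier PSL2R" "h \<in> carrier PSL2R" and \<gamma>: "geodesic_line \<gamma>" and "a \<noteq> b"
    and "psl_act g (\<gamma> a) = psl_act h (\<gamma> a)" "psl_act g (\<gamma> b) = psl_act h (\<gamma> b)"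
  shows "g = h"
proof -
  obtain k where k: "k \<in> carrier PSL2R" "\<gamma> = (\<lambda>t. psl_act k (vline t))"
    by (rule geodesic_line_cases[OF \<gamma>])
  have "(\<lambda>t. psl_act g (\<gamma> t)) = (\<lambda>t. psl_act h (\<gamma> t))"
    by (rule geodesic_line_eqI[of _ _ a b]) (use assms in \<open>auto intro: geodesic_line_psl_act\<close>)
  then have eq: "psl_act g (psl_act k (vline t)) = psl_act h (psl_act k (vline t))" for t
    unfolding k by meson
  have "inv\<^bsub>PSL2R\<^esub> (h \<otimes>\<^bsub>PSL2R\<^esub> k) \<otimes>\<^bsub>PSL2R\<^esub> (g \<otimes>\<^bsub>PSL2R\<^esub> k) = \<one>\<^bsub>PSL2R\<^esub>"
  proof (rule psl_act_vline_eq_one)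
    fix t
    have "psl_act (g \<otimes>\<^bsub>PSL2R\<^esub> k) (vline t) = psl_act (h \<otimes>\<^bsub>PSL2R\<^esub> k) (vline t)"
      using gh k(1) by (simp add: psl_act_mult eq)
    then show "psl_act (inv\<^bsub>PSL2R\<^esub> (h \<otimes>\<^bsub>PSL2R\<^esub> k) \<otimes>\<^bsub>PSL2R\<^esub> (g \<otimes>\<^bsub>PSL2R\<^esub> k)) (vline t) = vline t"
      using gh k(1) by (simp add: psl_act_mult[of "inv\<^bsub>PSL2R\<^esub> (h \<otimes>\<^bsub>PSL2R\<^esub> k)"])
  qed (use gh k(1) in simp)
  then have "g \<otimes>\<^bsub>PSL2R\<^esub> k = h \<otimes>\<^bsub>PSL2R\<^esub> k"
    using gh k(1) by (metis PSL2R.inv_equality PSL2R.inv_inv PSL2R.m_closed PSL2R.inv_closed)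
  then show ?thesis using gh k(1) by simp
qed

lemma geodesic_line_same_range:
  assumes "geodesic_line \<gamma>" "geodesic_line \<delta>" "range \<gamma> \<subseteq> range \<delta>"
  obtains e s where "\<bar>e\<bar> = 1" "\<gamma> = (\<lambda>t. \<delta> (e * t + s))"
proof -
  obtain s s' where s: "\<gamma> 0 = \<delta> s" "\<gamma> 1 = \<delta> s'"
    using assms(3) by (metis rangeE range_subsetD)
  have "\<bar>s' - s\<bar> = 1"
    using assms(1,2) hdist_geodesic_line by (metis abs_minus_commute abs_one diff_zero s)
  moreover from this have "\<gamma> = (\<lambda>t. \<delta> ((s' - s) * t + s))"
    using assms s by (intro geodesic_line_eqI[of _ _ 0 1] geodesic_line_reparam) auto
  ultimately show thesis by (rule that)
qed

text \<open>The factor \<open>D\<close> is the complex derivative at \<open>w\<close>. It is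
  obtained before the curve is chosen, so all curves through \<open>w\<close> share it; this
  uniformity is conformality.\<close>

lemma psl_act_has_vector_derivative:
  assumes "g \<in> carrier PSL2R" "w \<in> uhp"
  obtains D where "\<And>\<gamma> v t. (\<gamma> has_vector_derivative v) (at t) \<Longrightarrow> \<gamma> t = w \<Longrightarrow>
    ((\<lambda>t. psl_act g (\<gamma> t)) has_vector_derivative v * D) (at t)"
proof -
  obtain a b c d where g: "g = psl a b c d" "a*d - b*c = 1"
    by (rule PSL2R_cases[OF assms(1)])
  have "psl_act g = (\<lambda>z. (of_real a * z + of_real b) / (of_real c * z + of_real d))"
    by (simp add: g psl_act_psl fun_eq_iff)
  then have "psl_act g field_differentiable at w"
    using psl_denom_nonzero[OF g(2) assms(2)] by (auto intro!: derivative_intros)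
  then obtain D where D: "(psl_act g has_field_derivative D) (at w)"
    by (auto simp: field_differentiable_def)
  show thesis
    by (rule that[of D]) (use D field_vector_diff_chain_at in \<open>fastforce simp: o_def\<close>)
qed

lemma geodesic_line_differentiable:
  assumes "geodesic_line \<gamma>"
  shows "(\<gamma> has_vector_derivative vector_derivative \<gamma> (at t)) (at t)"
proof -
  obtain g where g: "g \<in> carrier PSL2R" "\<gamma> = (\<lambda>t. psl_act g (vline t))"
    by (rule geodesic_line_cases[OF assms])
  have "(vline has_vector_derivative Complex 0 (exp t)) (at t)"
    unfolding has_vector_derivative_complex_iff vline_def
    by (auto intro!: derivative_eq_intros)
  then have "\<exists>v. (\<gamma> has_vector_derivative v) (at t)"
    using psl_act_has_vector_derivative[OF g(1) vline_uhp[of t]] g(2) by metis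
  then show ?thesis
    using differentiableI_vector vector_derivative_works by blast
qed

text \<open>Both velocities are multiplied by the same complex number, so their ratio
  \<open>k\<close> is unchanged. With \<open>k = cis \<theta>\<close> this says that oriented angles
  are preserved.\<close>

lemma vector_derivative_psl_act_cmult:
  assumes "g \<in> carrier PSL2R" "geodesic_line \<gamma>" "geodesic_line \<delta>" "\<gamma> t = \<delta> t"
    and "vector_derivative \<delta> (at t) = k * vector_derivative \<gamma> (at t)"
  shows "vector_derivative (\<lambda>t. psl_act g (\<delta> t)) (at t) =
    k * vector_derivative (\<lambda>t. psl_act g (\<gamma> t)) (at t)"
proof -
  obtain D where D: "\<And>\<gamma>' v u. (\<gamma>' has_vector_derivative v) (at u) \<Longrightarrow> \<gamma>' u = \<gamma> t \<Longrightarrow>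
    ((\<lambda>t. psl_act g (\<gamma>' t)) has_vector_derivative v * D) (at u)"
    using psl_act_has_vector_derivative[OF assms(1) geodesic_line_uhp[OF assms(2)]] by metis
  from D[OF geodesic_line_differentiable[OF assms(2)] refl]
    D[OF geodesic_line_differentiable[OF assms(3)] assms(4)[symmetric]]
  show ?thesis
    using assms(5) by (simp add: vector_derivative_at)
qed


section \<open>Fuchsian groups act properly discontinuously\<close>

lemma proj_eq_iff:
  assumes "subgroup \<Gamma> PSL2R" "z \<in> uhp" "w \<in> uhp"
  shows "proj \<Gamma> z = proj \<Gamma> w \<longleftrightarrow> (\<exists>k\<in>\<Gamma>. z = psl_act k w)"
proof
  have "psl_act \<one>\<^bsub>PSL2R\<^esub> z \<in> proj \<Gamma> z"
    unfolding proj_def using subgroup.one_closed[OF assms(1)] by blast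
  moreover assume "proj \<Gamma> z = proj \<Gamma> w"
  ultimately show "\<exists>k\<in>\<Gamma>. z = psl_act k w"
    by (auto simp: proj_def)
next
  have sub: "proj \<Gamma> (psl_act k u) \<subseteq> proj \<Gamma> u" if "k \<in> \<Gamma>" "u \<in> uhp" for k u
  proof (clarsimp simp: proj_def)
    fix h assume "h \<in> \<Gamma>"
    then have "psl_act h (psl_act k u) = psl_act (h \<otimes>\<^bsub>PSL2R\<^esub> k) u"
      using that assms(1) by (simp add: psl_act_mult subgroup.mem_carrier)
    then show "psl_act h (psl_act k u) \<in> (\<lambda>g. psl_act g u) ` \<Gamma>"
      using \<open>h \<in> \<Gamma>\<close> that assms(1) by (simp add: subgroup.m_closed)
  qed
  assume "\<exists>k\<in>\<Gamma>. z = psl_act k w"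
  then obtain k where k: "k \<in> \<Gamma>" "z = psl_act k w" by blast
  then have "w = psl_act (inv\<^bsub>PSL2R\<^esub> k) z" "inv\<^bsub>PSL2R\<^esub> k \<in> \<Gamma>"
    using assms by (simp_all add: subgroup.mem_carrier subgroup.m_inv_closed)
  then show "proj \<Gamma> z = proj \<Gamma> w"
    using k sub assms by (metis subset_antisym)
qed

text \<open>Openness of the singleton of the identity in \<Gamma> is pulled back along the quotient
  map to a neighbourhood of the unit matrix, which turns discreteness into a condition on the
  entries of a representing matrix.\<close>

lemma fuchsian_isolated_one:
  assumes "fuchsian \<Gamma>"
  obtains \<epsilon> where "\<epsilon> > 0" "\<And>a b c d. a*d - b*c = 1 \<Longrightarrow> psl a b c d \<in> \<Gamma> \<Longrightarrow>
    \<bar>a - 1\<bar> < \<epsilon> \<Longrightarrow> \<bar>b\<bar> < \<epsilon> \<Longrightarrow> \<bar>c\<bar> < \<epsilon> \<Longrightarrow> \<bar>d - 1\<bar> < \<epsilon> \<Longrightarrow> psl a b c d = \<one>\<^bsub>PSL2R\<^esub>"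
proof -
  have sg: "subgroup \<Gamma> PSL2R" and disc: "subtopology PSL2R_topology \<Gamma> = discrete_topology \<Gamma>"
    using assms by (auto simp: fuchsian_def)
  have "openin (subtopology PSL2R_topology \<Gamma>) {\<one>\<^bsub>PSL2R\<^esub>}"
    using sg by (simp add: disc subgroup.one_closed)
  then obtain U where U: "openin PSL2R_topology U" "{\<one>\<^bsub>PSL2R\<^esub>} = U \<inter> \<Gamma>"
    by (auto simp: openin_subtopology)
  define V where "V = {A \<in> carrier SL2R. {mat 1, - mat 1} #>\<^bsub>SL2R\<^esub> A \<in> U}"
  have "openin (top_of_set (carrier SL2R)) V"
    using U(1) by (simp add: PSL2R_topology_def openin_quotient_topology V_def)
  moreover have "mat 1 \<in> V"
    using U(2) one_PSL2R[unfolded psl_def, folded mat_1_mat2] by (auto simp: V_def SL2R_def)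
  ultimately obtain e where e: "e > 0" "\<And>A. A \<in> carrier SL2R \<Longrightarrow> dist A (mat 1) < e \<Longrightarrow> A \<in> V"
    unfolding openin_euclidean_subtopology_iff by metis
  \<comment> \<open>The norm of a matrix is at most the sum of the moduli of its four entries, hence
    a quarter of \<open>e\<close> for each.\<close>
  show thesis
  proof (rule that[of "e / 4"])
    fix a b c d
    assume *: "a*d - b*c = 1" "psl a b c d \<in> \<Gamma>" "\<bar>a - 1\<bar> < e/4" "\<bar>b\<bar> < e/4" "\<bar>c\<bar> < e/4" "\<bar>d - 1\<bar> < e/4"
    have "norm (mat2 a b c d - mat 1) \<le> (\<Sum>i\<in>UNIV. \<Sum>j\<in>UNIV. \<bar>(mat2 a b c d - mat 1) $ i $ j\<bar>)"
      unfolding norm_vec_def[of "mat2 a b c d - mat 1"]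
      by (rule order_trans[OF L2_set_le_sum]) (simp_all only: norm_ge_zero sum_mono norm_le_l1_cart)
    also have "\<dots> = \<bar>a - 1\<bar> + \<bar>b\<bar> + \<bar>c\<bar> + \<bar>d - 1\<bar>"
      by (simp add: sum_2 mat_def)
    also have "\<dots> < e" using * by linarith
    finally have "mat2 a b c d \<in> V"
      using * by (intro e) (auto simp: SL2R_def dist_norm)
    then show "psl a b c d = \<one>\<^bsub>PSL2R\<^esub>"
      using U(2) * by (auto simp: V_def simp flip: psl_def)
  qed (use e in simp)
qed

text \<open>The imaginary part \<open>a * Im w\<close> controls \<open>a\<close>, and then the real
  part \<open>a * Re w + b\<close> controls \<open>b\<close>.\<close>

lemma bounded_of_complex_affine:
  fixes a b :: real
  assumes "Im w > 0" "cmod (of_real a * w + of_real b) \<le> B"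
  shows "\<bar>a\<bar> \<le> B / Im w" "\<bar>b\<bar> \<le> B + B / Im w * \<bar>Re w\<bar>"
proof -
  have "\<bar>a * Im w\<bar> \<le> B"
    using order_trans[OF abs_Im_le_cmod assms(2)] by simp
  then show a: "\<bar>a\<bar> \<le> B / Im w"
    using assms(1) by (simp add: abs_mult field_simps)
  have "\<bar>a * Re w + b\<bar> \<le> B"
    using order_trans[OF abs_Re_le_cmod assms(2)] by simp
  moreover have "\<bar>a * Re w\<bar> \<le> B / Im w * \<bar>Re w\<bar>"
    unfolding abs_mult by (intro mult_right_mono a) simp
  ultimately show "\<bar>b\<bar> \<le> B + B / Im w * \<bar>Re w\<bar>" by linarith
qed

text \<open>If \<open>w\<close> moves by at most \<open>r\<close>, the height of its image is
  comparable to that of \<open>w\<close>. Since the two heights differ by the factor |cw + d|^2,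
  this bounds |cw + d|; as the image is also bounded, so is |aw + b|. The two moduli bound the four
  entries.\<close>

lemma psl_bounded_displacement:
  assumes w: "w \<in> uhp"
  obtains R where "\<And>a b c d. a*d - b*c = 1 \<Longrightarrow> hdist w (psl_act (psl a b c d) w) \<le> r \<Longrightarrow>
    \<bar>a\<bar> \<le> R \<and> \<bar>b\<bar> \<le> R \<and> \<bar>c\<bar> \<le> R \<and> \<bar>d\<bar> \<le> R"
proof -
  define v where "v = Im w"
  have v: "v > 0" using w by (simp add: v_def uhp_def)
  \<comment> \<open>With \<open>v\<close> and \<open>y\<close> the heights of \<open>w\<close> and
    its image, the distance formula gives v^2 + y^2 \<le> M v y, so each height is at most
    \<open>M\<close> times the other.\<close>
  define M where "M = 2 * cosh r"
  have M: "M \<ge> 2" by (simp add: M_def cosh_real_ge_1)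
  \<comment> \<open>A common bound for both affine expressions: the last summand is the bound for
    |cw + d|, and the first is that bound times the bound |w| + Mv for the modulus of the image
    point.\<close>
  define B where "B = sqrt M * (cmod w + M * v) + sqrt M"
  define R where "R = B / v + (B + B / v * \<bar>Re w\<bar>)"
  have "B \<ge> 0" using M v by (simp add: B_def)
  show thesis
  proof (rule that[of R])
    fix a b c d
    assume det: "a*d - b*c = 1" and r: "hdist w (psl_act (psl a b c d) w) \<le> r"
    define z where "z = psl_act (psl a b c d) w"
    define q where "q = of_real c * w + of_real d"
    have z: "z \<in> uhp" using w det by (simp add: z_def)
    define y where "y = Im z"
    have y: "y > 0" using z by (simp add: y_def uhp_def)
    have nz: "q \<noteq> 0" unfolding q_def by (rule psl_denom_nonzero[OF det w])
    have yq: "y * (cmod q)\<^sup>2 = v"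
      using nz Im_psl_act_psl[OF det, of w] by (simp add: y_def z_def q_def v_def)
    have "0 \<le> hdist w z" using w z by (rule hdist_nonneg)
    then have "cosh (hdist w z) \<le> cosh r"
      using r by (subst cosh_real_nonneg_le_iff) (auto simp: z_def)
    then have dist: "(cmod (w - z))\<^sup>2 \<le> v * y * (M - 2)"
      using v y unfolding cmod_diff_power2_hdist[OF w z] by (simp add: M_def v_def y_def)
    have "(v - y)\<^sup>2 \<le> (cmod (w - z))\<^sup>2"
      using power_mono[OF abs_Im_le_cmod[of "w - z"] abs_ge_zero, of 2] by (simp add: v_def y_def)
    then have *: "v\<^sup>2 + y\<^sup>2 \<le> M * v * y"
      using dist by (simp add: power2_eq_square algebra_simps)
    have "v\<^sup>2 \<le> M * v * y" "y\<^sup>2 \<le> M * v * y"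
      using * zero_le_power2[of v] zero_le_power2[of y] by linarith+
    then have "v * v \<le> M * y * v" "y * y \<le> M * v * y"
      by (simp_all add: power2_eq_square mult_ac)
    then have vy: "v \<le> M * y" "y \<le> M * v"
      using v y by simp_all
    have "y * (cmod q)\<^sup>2 \<le> y * M" using yq vy by (simp add: mult.commute)
    then have "(cmod q)\<^sup>2 \<le> M" using y by simp
    then have q: "cmod q \<le> sqrt M" by (rule real_le_rsqrt)
    have "v * y * (M - 2) \<le> v * (M * v) * M"
      using vy v y M by (intro mult_mono) auto
    then have "(cmod (w - z))\<^sup>2 \<le> (M * v)\<^sup>2"
      using dist by (simp add: power2_eq_square mult_ac)
    then have "cmod (w - z) \<le> M * v"
      by (rule power2_le_imp_le) (use M v in simp)
    then have "cmod z \<le> cmod w + M * v"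
      using norm_triangle_sub[of z w] by (simp add: norm_minus_commute)
    then have "cmod z * cmod q \<le> (cmod w + M * v) * sqrt M"
      using q v M by (intro mult_mono) auto
    moreover have "of_real a * w + of_real b = z * q"
      using nz by (simp add: z_def q_def psl_act_psl)
    ultimately have p: "cmod (of_real a * w + of_real b) \<le> B"
      using M by (simp add: B_def norm_mult mult.commute add.commute add_increasing)
    have "sqrt M \<le> B" using M v by (simp add: B_def)
    then have q': "cmod (of_real c * w + of_real d) \<le> B"
      using q by (simp add: q_def)
    have "B / v \<le> R" "B + B / v * \<bar>Re w\<bar> \<le> R"
      using \<open>B \<ge> 0\<close> v by (auto simp: R_def)
    then show "\<bar>a\<bar> \<le> R \<and> \<bar>b\<bar> \<le> R \<and> \<bar>c\<bar> \<le> R \<and> \<bar>d\<bar> \<le> R"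
      using bounded_of_complex_affine[OF _ p] bounded_of_complex_affine[OF _ q'] v
      unfolding v_def by fastforce
  qed
qed

lemma abs_diff_less_of_floor_eq:
  fixes x y \<delta> :: real
  assumes "\<lfloor>x / \<delta>\<rfloor> = \<lfloor>y / \<delta>\<rfloor>" "\<delta> > 0"
  shows "\<bar>x - y\<bar> < \<delta>"
proof -
  have "\<bar>x / \<delta> - y / \<delta>\<bar> < 1" using assms(1) by linarith
  then have "\<bar>(x - y) / \<delta>\<bar> < 1" by (simp add: diff_divide_distrib)
  then show ?thesis using assms(2) by (simp add: abs_divide)
qed

text \<open>If two elements of \<open>\<Gamma>\<close> have close bounded matrices \<open>A\<close>, \<open>B\<close>, then the inverse of \<open>A\<close> times
  \<open>B\<close> is close to the identity. So, for a fine enough grid, the grid cell of a representing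
  matrix determines the element.\<close>

lemma fuchsian_finite_displacement:
  assumes \<Gamma>: "fuchsian \<Gamma>" and w: "w \<in> uhp"
  shows "finite {k \<in> \<Gamma>. hdist w (psl_act k w) \<le> r}"
proof -
  have sg: "subgroup \<Gamma> PSL2R" using \<Gamma> by (simp add: fuchsian_def)
  obtain \<epsilon> where \<epsilon>: "\<epsilon> > 0" "\<And>a b c d. a*d - b*c = 1 \<Longrightarrow> psl a b c d \<in> \<Gamma> \<Longrightarrow>
    \<bar>a - 1\<bar> < \<epsilon> \<Longrightarrow> \<bar>b\<bar> < \<epsilon> \<Longrightarrow> \<bar>c\<bar> < \<epsilon> \<Longrightarrow> \<bar>d - 1\<bar> < \<epsilon> \<Longrightarrow> psl a b c d = \<one>\<^bsub>PSL2R\<^esub>"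
    using fuchsian_isolated_one[OF \<Gamma>] by metis
  obtain R0 where R0: "\<And>a b c d. a*d - b*c = 1 \<Longrightarrow> hdist w (psl_act (psl a b c d) w) \<le> r \<Longrightarrow>
    \<bar>a\<bar> \<le> R0 \<and> \<bar>b\<bar> \<le> R0 \<and> \<bar>c\<bar> \<le> R0 \<and> \<bar>d\<bar> \<le> R0"
    using psl_bounded_displacement[OF w] by metis
  define R where "R = \<bar>R0\<bar> + 1"
  \<comment> \<open>Each entry to be estimated is a sum of two products of an entry of size at most
    \<open>R\<close> with a difference below \<delta>, hence smaller than 2R\<delta> =
    \<epsilon>.\<close>
  define \<delta> where "\<delta> = \<epsilon> / (2 * R)"
  have "R > 0" by (simp add: R_def)
  have "\<delta> > 0" using \<epsilon> \<open>R > 0\<close> by (simp add: \<delta>_def)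
  define K where "K = {k \<in> \<Gamma>. hdist w (psl_act k w) \<le> r}"
  define S where "S = {(a, b, c, d). a*d - b*c = 1 \<and> psl a b c d \<in> K}"
  define cell where "cell = (\<lambda>(a, b, c, d). (\<lfloor>a / \<delta>\<rfloor>, \<lfloor>b / \<delta>\<rfloor>, \<lfloor>c / \<delta>\<rfloor>, \<lfloor>d / \<delta>\<rfloor>))"
  have R: "\<bar>a\<bar> \<le> R \<and> \<bar>b\<bar> \<le> R \<and> \<bar>c\<bar> \<le> R \<and> \<bar>d\<bar> \<le> R" if "(a, b, c, d) \<in> S" for a b c d
    using R0[of a d b c] that by (auto simp: S_def K_def R_def)
  have small: "\<bar>x * p + y * q\<bar> < \<epsilon>" if "\<bar>x\<bar> \<le> R" "\<bar>y\<bar> \<le> R" "\<bar>p\<bar> < \<delta>" "\<bar>q\<bar> < \<delta>" for x y p q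
  proof -
    have "\<bar>x * p + y * q\<bar> \<le> R * \<bar>p\<bar> + R * \<bar>q\<bar>"
      using that by (intro order_trans[OF abs_triangle_ineq] add_mono)
        (auto simp: abs_mult intro: mult_right_mono)
    also have "\<dots> < R * \<delta> + R * \<delta>"
      using that \<open>R > 0\<close> by (intro add_strict_mono) auto
    also have "\<dots> = \<epsilon>" using \<open>R > 0\<close> by (simp add: \<delta>_def)
    finally show ?thesis .
  qed
  have same: "psl a b c d = psl a' b' c' d'"
    if "(a, b, c, d) \<in> S" "(a', b', c', d') \<in> S" "cell (a, b, c, d) = cell (a', b', c', d')"
    for a b c d a' b' c' d'
  proof -
    have det: "a*d - b*c = 1" "a'*d' - b'*c' = 1" and mem: "psl a b c d \<in> \<Gamma>" "psl a' b' c' d' \<in> \<Gamma>"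
      using that by (auto simp: S_def K_def)
    have near: "\<bar>a' - a\<bar> < \<delta>" "\<bar>b' - b\<bar> < \<delta>" "\<bar>c' - c\<bar> < \<delta>" "\<bar>d' - d\<bar> < \<delta>"
      using that(3) \<open>\<delta> > 0\<close> by (auto simp: cell_def intro!: abs_diff_less_of_floor_eq)
    have det': "d * a - (- b) * (- c) = 1" using det by (simp add: mult.commute)
    have "psl d (-b) (-c) a \<otimes>\<^bsub>PSL2R\<^esub> psl a b c d = \<one>\<^bsub>PSL2R\<^esub>"
      using det psl_mult[OF det' det(1)] by (simp add: one_PSL2R mult.commute)
    then have inv: "psl d (-b) (-c) a = inv\<^bsub>PSL2R\<^esub> (psl a b c d)"
      using det det' by (simp add: PSL2R.inv_equality)
    have prod: "psl d (-b) (-c) a \<otimes>\<^bsub>PSL2R\<^esub> psl a' b' c' d' =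
        psl (d*a' - b*c') (d*b' - b*d') (a*c' - c*a') (a*d' - c*b')"
      using psl_mult[OF det' det(2)] by (simp add: algebra_simps)
    have "psl (d*a' - b*c') (d*b' - b*d') (a*c' - c*a') (a*d' - c*b') = \<one>\<^bsub>PSL2R\<^esub>"
    proof (rule \<epsilon>(2))
      show "(d*a' - b*c') * (a*d' - c*b') - (d*b' - b*d') * (a*c' - c*a') = 1"
        using det by algebra
      show "psl (d*a' - b*c') (d*b' - b*d') (a*c' - c*a') (a*d' - c*b') \<in> \<Gamma>"
        using mem sg by (simp add: inv subgroup.m_inv_closed subgroup.m_closed flip: prod)
      \<comment> \<open>These are the entries of A^-1 B - A^-1 A, where A and B are the matrices
        with unprimed and primed entries.\<close>
      have "d*a' - b*c' - 1 = d * (a' - a) + (-b) * (c' - c)" "d*b' - b*d' = d * (b' - b) + (-b) * (d' - d)"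
        "a*c' - c*a' = a * (c' - c) + (-c) * (a' - a)" "a*d' - c*b' - 1 = a * (d' - d) + (-c) * (b' - b)"
        using det by algebra+
      with small near R[OF that(1)]
      show "\<bar>d*a' - b*c' - 1\<bar> < \<epsilon>" "\<bar>d*b' - b*d'\<bar> < \<epsilon>"
        "\<bar>a*c' - c*a'\<bar> < \<epsilon>" "\<bar>a*d' - c*b' - 1\<bar> < \<epsilon>"
        by (metis abs_minus_cancel)+
    qed
    then show ?thesis
      using prod inv det det' by (metis PSL2R.inv_equality PSL2R.inv_inv PSL2R.inv_closed psl_in_carrier)
  qed
  let ?I = "{\<lfloor>- R / \<delta>\<rfloor>..\<lfloor>R / \<delta>\<rfloor>}"
  have mono: "\<lfloor>x / \<delta>\<rfloor> \<in> ?I" if "\<bar>x\<bar> \<le> R" for x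
    using that \<open>\<delta> > 0\<close> divide_right_mono[of "- R" x \<delta>] divide_right_mono[of x R \<delta>]
    by (auto intro!: floor_mono)
  have "cell ` S \<subseteq> ?I \<times> ?I \<times> ?I \<times> ?I"
  proof (rule image_subsetI)
    fix p assume "p \<in> S"
    moreover obtain a b c d where "p = (a, b, c, d)" by (cases p)
    ultimately show "cell p \<in> ?I \<times> ?I \<times> ?I \<times> ?I"
      using R[of a b c d] unfolding cell_def by (simp only: prod.case) (intro SigmaI mono; simp)
  qed
  then have "finite (cell ` S)"
    by (rule finite_subset) simp
  \<comment> \<open>One matrix is picked from each occupied cell; by \<open>same\<close> it
    represents the same element of \<open>PSL2R\<close> as every other matrix of \<open>S\<close> in
    the cell.\<close>
  moreover have "K \<subseteq> (\<lambda>p. (\<lambda>(a, b, c, d). psl a b c d) (inv_into S cell p)) ` cell ` S"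
  proof
    fix k assume k: "k \<in> K"
    then have "k \<in> carrier PSL2R" using sg by (auto simp: K_def subgroup.mem_carrier)
    then obtain a b c d where abcd: "k = psl a b c d" "a*d - b*c = 1" by (rule PSL2R_cases)
    then have S: "(a, b, c, d) \<in> S" using k by (simp add: S_def)
    define s where "s = inv_into S cell (cell (a, b, c, d))"
    have "s \<in> S" "cell s = cell (a, b, c, d)"
      unfolding s_def using S by (auto intro: inv_into_into f_inv_into_f)
    then have "(\<lambda>(a, b, c, d). psl a b c d) s = k"
      using same[OF S] abcd by (cases s) auto
    then show "k \<in> (\<lambda>p. (\<lambda>(a, b, c, d). psl a b c d) (inv_into S cell p)) ` cell ` S"
      using S unfolding s_def by blast
  qed
  ultimately have "finite K" by (meson finite_imageI finite_subset)
  then show ?thesis by (simp add: K_def)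
qed

lemma fuchsian_countable:
  assumes "fuchsian \<Gamma>"
  shows "countable \<Gamma>"
proof -
  have "\<Gamma> = (\<Union>n. {k \<in> \<Gamma>. hdist (vline 0) (psl_act k (vline 0)) \<le> real n})"
    by (auto intro: real_arch_simple)
  also have "countable \<dots>"
    using fuchsian_finite_displacement[OF assms vline_uhp]
    by (intro countable_UN) (auto intro: countable_finite)
  finally show ?thesis .
qed


section \<open>Axes\<close>

lemma hyperbolic_element_psl:
  assumes "a*d - b*c = 1"
  shows "hyperbolic_element (psl a b c d) \<longleftrightarrow> \<bar>a + d\<bar> > 2"
proof -
  have "(\<exists>A\<in>psl a b c d. \<bar>trace A\<bar> > 2) \<longleftrightarrow> \<bar>a + d\<bar> > 2"
    unfolding psl_eq by auto
  then show ?thesis using assms by (simp add: hyperbolic_element_def)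
qed

text \<open>A hyperbolic element together with a parametrisation of its axis. The sign of
  \<open>l\<close> is left free, so that reversing \<gamma> stays within the notion.\<close>

definition translates :: "(real^2^2) set \<Rightarrow> (real \<Rightarrow> complex) \<Rightarrow> real \<Rightarrow> bool" where
  "translates g \<gamma> l \<longleftrightarrow> geodesic_line \<gamma> \<and> l \<noteq> 0 \<and> (\<forall>t. psl_act g (\<gamma> t) = \<gamma> (t + l))"

lemma translates_conj:
  assumes "g \<in> carrier PSL2R" "h \<in> carrier PSL2R" "translates g \<gamma> l"
  shows "translates (h \<otimes>\<^bsub>PSL2R\<^esub> g \<otimes>\<^bsub>PSL2R\<^esub> inv\<^bsub>PSL2R\<^esub> h) (\<lambda>t. psl_act h (\<gamma> t)) l"
  using assms by (simp add: translates_def geodesic_line_psl_act psl_act_mult)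

lemma translates_reparam:
  assumes "translates g \<gamma> l" "\<bar>e\<bar> = 1"
  shows "translates g (\<lambda>t. \<gamma> (e * t + s)) (e * l)"
proof -
  have "e * e = 1" using assms(2) by (metis abs_mult_self mult_1)
  then have "e * (t + e * l) + s = e * t + s + l" for t
    by (simp add: distrib_left flip: mult.assoc)
  with assms show ?thesis
    unfolding translates_def by (metis geodesic_line_reparam mult_eq_0_iff abs_zero zero_neq_one)
qed

lemma translates_range:
  assumes "translates g \<gamma> l"
  shows "psl_act g ` range \<gamma> = range \<gamma>"
proof -
  have "psl_act g ` range \<gamma> = range (\<lambda>t. \<gamma> (t + l))"
    using assms by (simp add: translates_def image_image)
  also have "\<dots> = range \<gamma>"
  proof (intro equalityI subsetI)
    fix z assume "z \<in> range \<gamma>"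
    then obtain t where "z = \<gamma> ((t - l) + l)" by auto
    then show "z \<in> range (\<lambda>t. \<gamma> (t + l))" by blast
  qed blast
  finally show ?thesis .
qed

lemma translates_dil: "l \<noteq> 0 \<Longrightarrow> translates (dil l) vline l"
  by (simp add: translates_def dil_vline geodesic_line_vline)

lemma translates_cases:
  assumes "g \<in> carrier PSL2R" "translates g \<gamma> l"
  obtains h where "h \<in> carrier PSL2R" "\<gamma> = (\<lambda>t. psl_act h (vline t))"
    "g = h \<otimes>\<^bsub>PSL2R\<^esub> dil l \<otimes>\<^bsub>PSL2R\<^esub> inv\<^bsub>PSL2R\<^esub> h"
proof -
  have \<gamma>: "geodesic_line \<gamma>" and l: "l \<noteq> 0" and g: "\<And>t. psl_act g (\<gamma> t) = \<gamma> (t + l)"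
    using assms(2) by (auto simp: translates_def)
  obtain h where h: "h \<in> carrier PSL2R" "\<gamma> = (\<lambda>t. psl_act h (vline t))"
    by (rule geodesic_line_cases[OF \<gamma>])
  let ?g' = "h \<otimes>\<^bsub>PSL2R\<^esub> dil l \<otimes>\<^bsub>PSL2R\<^esub> inv\<^bsub>PSL2R\<^esub> h"
  have "translates ?g' \<gamma> l"
    unfolding h(2) by (intro translates_conj translates_dil h l dil_carrier)
  then have g': "\<And>t. psl_act ?g' (\<gamma> t) = \<gamma> (t + l)"
    by (simp add: translates_def)
  have "g = ?g'"
    by (rule psl_act_eqI[OF assms(1) _ \<gamma>, of _ 0 1]) (use h g g' in simp_all)
  with h show thesis by (rule that)
qed

text \<open>The element is conjugate to \<open>dil l\<close>, whose matrix has trace e^(l/2) +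
  e^(-l/2). The trace is invariant under conjugation, and the sum of two distinct positive numbers
  with product 1 exceeds 2.\<close>

lemma translates_hyperbolic:
  assumes g: "g \<in> carrier PSL2R" "translates g \<gamma> l"
  shows "hyperbolic_element g"
proof -
  obtain h where h: "h \<in> carrier PSL2R" "g = h \<otimes>\<^bsub>PSL2R\<^esub> dil l \<otimes>\<^bsub>PSL2R\<^esub> inv\<^bsub>PSL2R\<^esub> h"
    by (rule translates_cases[OF g])
  obtain p q r s where pqrs: "h = psl p q r s" "p * s - q*r = 1"
    by (rule PSL2R_cases[OF h(1)])
  define x where "x = exp (l/2)"
  define y where "y = exp (-l/2)"
  have xy: "x * y = 1" by (simp add: x_def y_def flip: exp_add)
  have dil: "dil l = psl x 0 0 y" by (simp add: dil_def x_def y_def)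
  have det1: "x * y - 0 * 0 = 1" using xy by simp
  have det': "s * p - (- q) * (- r) = 1" using pqrs by (simp add: mult.commute)
  have "psl s (-q) (-r) p \<otimes>\<^bsub>PSL2R\<^esub> h = \<one>\<^bsub>PSL2R\<^esub>"
    using pqrs psl_mult[OF det' pqrs(2)] by (simp add: one_PSL2R mult.commute)
  then have inv: "inv\<^bsub>PSL2R\<^esub> h = psl s (-q) (-r) p"
    using h(1) det' by (simp add: PSL2R.inv_equality)
  have hd: "h \<otimes>\<^bsub>PSL2R\<^esub> dil l = psl (p*x) (q*y) (r*x) (s*y)"
    unfolding pqrs dil psl_mult[OF pqrs(2) det1] by simp
  have det2: "(p*x) * (s*y) - (q*y) * (r*x) = 1"
    using pqrs(2) xy by algebra
  have g': "g = psl (p*x * s - q*y*r) (q*y*p - p*x*q) (r*x * s - s*y*r) (s*y*p - r*x*q)"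
    unfolding h(2) hd inv psl_mult[OF det2 det'] by (simp add: algebra_simps)
  have det3: "(p*x * s - q*y*r) * (s*y*p - r*x*q) - (q*y*p - p*x*q) * (r*x * s - s*y*r) = 1"
    using pqrs(2) xy by algebra
  have "p*x * s - q*y*r + (s*y*p - r*x*q) = x + y"
    using pqrs(2) by algebra
  moreover have "x + y > 2"
  proof -
    have "l \<noteq> 0" using g(2) by (simp add: translates_def)
    then have "x \<noteq> y" by (simp add: x_def y_def)
    then have "(x - y)\<^sup>2 > 0" by simp
    then have "(x + y)\<^sup>2 > 2\<^sup>2" using xy by (simp add: power2_eq_square algebra_simps)
    moreover have "x + y > 0" by (simp add: x_def y_def add_pos_pos)
    ultimately show ?thesis by (intro power_less_imp_less_base[of 2 2]) auto
  qed
  ultimately show ?thesis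
    unfolding g' hyperbolic_element_psl[OF det3] by simp
qed

text \<open>The last four assumptions say that the columns (p, r) and (q, s) are eigenvectors for
  the eigenvalues x and y = 1/x. The matrix with these columns conjugates \<open>psl a b c d\<close>
  to the diagonal matrix of \<open>dil l\<close>, and x = e^(l/2) gives the length.\<close>

lemma psl_translates:
  assumes g: "a*d - b*c = 1" and h: "p * s - q*r = 1" and xy: "x > 0" "x \<noteq> 1" "x * y = 1"
    and "a*p + b*r = x*p" "c*p + d*r = x*r" "a*q + b * s = y*q" "c*q + d * s = y * s"
  shows "translates (psl a b c d) (\<lambda>t. psl_act (psl p q r s) (vline t)) (2 * ln x)"
proof -
  have y: "y = 1 / x" using xy by (simp add: field_simps)
  have dil: "dil (2 * ln x) = psl x 0 0 y"
  proof -
    have "exp (- ln x) = y"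
      unfolding y using xy(1) by (simp add: exp_minus inverse_eq_divide)
    then show ?thesis using xy(1) by (simp add: dil_def)
  qed
  have "x * y - 0 * 0 = 1" using xy by simp
  then have "psl p q r s \<otimes>\<^bsub>PSL2R\<^esub> dil (2 * ln x) = psl (x*p) (y*q) (x*r) (y * s)"
    unfolding dil by (simp add: psl_mult[OF h] mult.commute)
  moreover have "psl a b c d \<otimes>\<^bsub>PSL2R\<^esub> psl p q r s = psl (x*p) (y*q) (x*r) (y * s)"
    by (simp only: psl_mult[OF g h] assms(6-9))
  ultimately have eq: "psl a b c d \<otimes>\<^bsub>PSL2R\<^esub> psl p q r s = psl p q r s \<otimes>\<^bsub>PSL2R\<^esub> dil (2 * ln x)"
    by simp
  have "psl_act (psl a b c d) (psl_act (psl p q r s) (vline t)) =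
      psl_act (psl p q r s) (vline (t + 2 * ln x))" for t
    using arg_cong[OF eq, of "\<lambda>k. psl_act k (vline t)"] g h
    by (simp add: psl_act_mult dil_vline)
  moreover have "2 * ln x \<noteq> 0" using xy by simp
  ultimately show ?thesis
    using h by (simp add: translates_def geodesic_line_psl_act geodesic_line_vline)
qed

text \<open>Choosing the representative of positive trace makes both eigenvalues positive, as a
  comparison with \<open>dil\<close> demands; what remains is diagonalisation. For
  \<open>c = 0\<close> the eigenvalues are the diagonal entries, with eigenvectors (1, 0) and (b /
  (d - a), 1).\<close>

lemma hyperbolic_element_translates:
  assumes "hyperbolic_element g"
  obtains \<gamma> l where "translates g \<gamma> l"
proof -
  have "g \<in> carrier PSL2R" using assms by (simp add: hyperbolic_element_def)
  then obtain a' b' c' d' where g': "g = psl a' b' c' d'" "a'*d' - b'*c' = 1"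
    by (rule PSL2R_cases)
  then have tr': "\<bar>a' + d'\<bar> > 2" using assms hyperbolic_element_psl by blast
  obtain a b c d where g: "g = psl a b c d" "a*d - b*c = 1" and tr: "a + d > 2"
  proof (cases "a' + d' > 0")
    case True
    then show ?thesis using that g' tr' by simp
  next
    case False
    then show ?thesis using that[of "-a'" "-b'" "-c'" "-d'"] g' tr' by (simp add: psl_uminus)
  qed
  show thesis
  proof (cases "c = 0")
    case True
    then have ad: "a * d = 1" using g by simp
    then have "a > 0" using tr by (smt (verit) mult_le_0_iff)
    have "a \<noteq> 1" using ad tr by auto
    have "a \<noteq> d"
    proof
      assume "a = d"
      then have "a = 1 \<or> a = -1" using ad by (simp add: square_eq_1_iff)
      then show False using \<open>a > 0\<close> \<open>a \<noteq> 1\<close> by simp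
    qed
    have "translates (psl a b c d) (\<lambda>t. psl_act (psl 1 (b / (d - a)) 0 1) (vline t)) (2 * ln a)"
    proof (rule psl_translates[where y = d])
      show "a * (b / (d - a)) + b * 1 = d * (b / (d - a))"
        using \<open>a \<noteq> d\<close> by (simp add: divide_simps) (simp add: algebra_simps)
    qed (use True ad g \<open>a > 0\<close> \<open>a \<noteq> 1\<close> in auto)
    then show ?thesis using that g(1) by blast
  next
    case False
    \<comment> \<open>\<open>D\<close> is the root of the discriminant of the characteristic
      polynomial X^2 - (a + d) X + 1, and \<open>x\<close>, \<open>y\<close> below are its
      zeros.\<close>
    define D where "D = sqrt ((a + d)\<^sup>2 - 4)"
    have "(a + d)\<^sup>2 > 2\<^sup>2" using tr by (intro power_strict_mono) auto
    then have D: "D > 0" "D\<^sup>2 = (a + d)\<^sup>2 - 4" by (auto simp: D_def)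
    define x where "x = (a + d + D) / 2"
    define y where "y = (a + d - D) / 2"
    have xy: "x * y = 1" "x + y = a + d" "x - y = D"
      using D by (simp_all add: x_def y_def power2_eq_square field_simps)
    have x: "x > 1" using tr D by (simp add: x_def)
    have x2: "x * x = x * (a + d) - 1" and y2: "y * y = y * (a + d) - 1"
      using xy by algebra+
    have ne: "x \<noteq> y" using xy D by auto
    \<comment> \<open>The columns are the eigenvectors (x - d, c) and (y - d, c); the second is
      divided by c (x - y) to obtain determinant 1.\<close>
    have "translates (psl a b c d) (\<lambda>t. psl_act (psl (x - d) ((y - d) / (c * (x - y))) c (1 / (x - y))) (vline t)) (2 * ln x)"
    proof (rule psl_translates[where y = y])
      show "(x - d) * (1 / (x - y)) - (y - d) / (c * (x - y)) * c = 1"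
      proof -
        have "(y - d) / (c * (x - y)) * c = (y - d) / (x - y)" using False by simp
        then show ?thesis using ne by (simp flip: diff_divide_distrib)
      qed
      show "a * (x - d) + b * c = x * (x - d)"
        using g(2) x2 by algebra
      show "c * (x - d) + d * c = x * c"
        by (simp add: algebra_simps)
      have "a * (y - d) + b * c = y * (y - d)" using g(2) y2 by algebra
      then show "a * ((y - d) / (c * (x - y))) + b * (1 / (x - y)) = y * ((y - d) / (c * (x - y)))"
        using False ne by (simp add: divide_simps)
      show "c * ((y - d) / (c * (x - y))) + d * (1 / (x - y)) = y * (1 / (x - y))"
        using False ne by (simp add: divide_simps)
    qed (use g x xy in auto)
    then show ?thesis using that g(1) by blast
  qed
qed

text \<open>The end points of the image line are q/u and p/r, and invariance under multiplication by
  e^l \<noteq> 1 leaves only 0 and \<infinity> for them. Algebraically this is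
  \<open>q * u = 0\<close> and \<open>p * r = 0\<close>, which makes the image purely
  imaginary.\<close>

lemma dil_psl_invariant:
  assumes h: "h \<in> carrier PSL2R" and "l \<noteq> 0"
    and eq: "\<And>t. psl_act (dil l) (psl_act h (vline t)) = psl_act h (vline (t + s))"
  shows "psl_act h (vline t) \<in> range vline"
proof -
  obtain p q r u where pqru: "h = psl p q r u" "p*u - q*r = 1"
    by (rule PSL2R_cases[OF h])
  have dil_act: "psl_act (dil l) z = of_real (exp l) * z" for z
  proof -
    have "exp (l/2) = exp l * exp (- (l/2))" by (simp flip: exp_add)
    then show ?thesis by (simp add: dil_def psl_act_psl)
  qed
  have coeff: "q * u = p * r * exp (2 * t + s)" for t
  proof -
    define z where "z = vline t"
    define z' where "z' = vline (t + s)"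
    have nz: "of_real r * z + of_real u \<noteq> 0" "of_real r * z' + of_real u \<noteq> 0"
      unfolding z_def z'_def by (intro psl_denom_nonzero[OF pqru(2)] vline_uhp)+
    have "of_real (exp l) * ((of_real p * z + of_real q) / (of_real r * z + of_real u)) =
      (of_real p * z' + of_real q) / (of_real r * z' + of_real u)"
      using eq[of t] by (simp add: dil_act pqru(1) psl_act_psl z_def z'_def)
    then have "of_real (exp l) * (of_real p * z + of_real q) * (of_real r * z' + of_real u) =
      (of_real p * z' + of_real q) * (of_real r * z + of_real u)"
      using nz by (simp add: frac_eq_eq)
    \<comment> \<open>As \<open>z\<close> and \<open>z'\<close> are purely imaginary, the real part
      isolates the products \<open>q * u\<close> and \<open>p * r\<close>.\<close>
    then have "Re (of_real (exp l) * (of_real p * z + of_real q) * (of_real r * z' + of_real u)) =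
      Re ((of_real p * z' + of_real q) * (of_real r * z + of_real u))"
      by simp
    then have "exp l * (q * u) - exp l * (p * exp t * (r * exp (t + s))) =
        q * u - p * exp (t + s) * (r * exp t)"
      by (simp add: z_def z'_def vline_def algebra_simps)
    then have "(exp l - 1) * (q * u - p * r * (exp t * exp (t + s))) = 0"
      by (simp add: algebra_simps)
    moreover have "exp t * exp (t + s) = exp (2 * t + s)" by (simp flip: exp_add)
    ultimately show ?thesis using \<open>l \<noteq> 0\<close> by simp
  qed
  have "p * r * (exp (2 * 1 + s) - exp (2 * 0 + s)) = 0"
    using coeff[of 1] coeff[of 0] by (simp add: algebra_simps)
  then have "p * r = 0" by simp
  then have "q * u = 0" using coeff[of 0] by simp
  have "Re (psl_act h (vline t)) = 0"
    using \<open>p * r = 0\<close> \<open>q * u = 0\<close> by (auto simp: pqru(1) psl_act_psl Re_divide vline_def)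
  moreover have "Im (psl_act h (vline t)) > 0"
    using psl_act_uhp[OF h vline_uhp[of t]] by (simp add: uhp_def)
  ultimately have "psl_act h (vline t) = vline (ln (Im (psl_act h (vline t))))"
    by (simp add: vline_def complex_eq_iff)
  then show ?thesis by (rule range_eqI)
qed

lemma geodesic_line_range_eqI:
  assumes "geodesic_line \<gamma>" "geodesic_line \<delta>" "range \<gamma> \<subseteq> range \<delta>"
  shows "range \<gamma> = range \<delta>"
proof -
  obtain e s where e: "\<bar>e\<bar> = 1" "\<gamma> = (\<lambda>t. \<delta> (e * t + s))"
    by (rule geodesic_line_same_range[OF assms])
  have "range (\<lambda>t. e * t + s) = UNIV"
    using e(1) by (intro surjI[of _ "\<lambda>t. (t - s) / e"]) auto
  moreover have "range \<gamma> = \<delta> ` range (\<lambda>t. e * t + s)"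
    by (simp add: e(2) image_image)
  ultimately show ?thesis by simp
qed

text \<open>On an invariant line \<delta>, \<open>g\<close> acts by an isometry of the parameter.
  Once reversal is excluded it is a shift, and in coordinates where \<gamma> is the imaginary axis
  the previous end point argument applies.\<close>

lemma translates_invariant_unique:
  assumes g: "g \<in> carrier PSL2R" "translates g \<gamma> l"
    and \<delta>: "geodesic_line \<delta>" "psl_act g ` range \<delta> = range \<delta>"
  shows "range \<delta> = range \<gamma>"
proof -
  have \<gamma>: "geodesic_line \<gamma>" and l: "l \<noteq> 0" and g\<gamma>: "\<And>t. psl_act g (\<gamma> t) = \<gamma> (t + l)"
    using g(2) by (auto simp: translates_def)
  have "range (\<lambda>t. psl_act g (\<delta> t)) \<subseteq> range \<delta>"
    using \<delta>(2) by (simp add: image_image)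
  then obtain e s where e: "\<bar>e\<bar> = 1" and "(\<lambda>t. psl_act g (\<delta> t)) = (\<lambda>t. \<delta> (e * t + s))"
    using geodesic_line_same_range geodesic_line_psl_act[OF g(1) \<delta>(1)] \<delta>(1) by metis
  then have g\<delta>: "psl_act g (\<delta> t) = \<delta> (e * t + s)" for t by metis
  \<comment> \<open>An element reversing \<delta> has a square that fixes \<delta> pointwise and so
    is trivial, whereas the square of \<open>g\<close> moves the points of \<gamma> by 2l.\<close>
  have "e \<noteq> -1"
  proof
    assume "e = -1"
    then have "g \<otimes>\<^bsub>PSL2R\<^esub> g = \<one>\<^bsub>PSL2R\<^esub>"
      using g(1) \<delta>(1) by (intro psl_act_eqI[of _ _ \<delta> 0 1]) (simp_all add: psl_act_mult g\<delta>)
    then have "psl_act (g \<otimes>\<^bsub>PSL2R\<^esub> g) (\<gamma> 0) = \<gamma> 0" by simp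
    then have "\<gamma> (l + l) = \<gamma> 0" using g(1) \<gamma> by (simp add: psl_act_mult g\<gamma>)
    then have "hdist (\<gamma> (l + l)) (\<gamma> 0) = 0" by simp
    then show False using \<gamma> l by (simp add: hdist_geodesic_line)
  qed
  then have "e = 1" using e by auto
  obtain h where h: "h \<in> carrier PSL2R" "\<gamma> = (\<lambda>t. psl_act h (vline t))"
    "g = h \<otimes>\<^bsub>PSL2R\<^esub> dil l \<otimes>\<^bsub>PSL2R\<^esub> inv\<^bsub>PSL2R\<^esub> h"
    by (rule translates_cases[OF g])
  obtain k where k: "k \<in> carrier PSL2R" "\<delta> = (\<lambda>t. psl_act k (vline t))"
    by (rule geodesic_line_cases[OF \<delta>(1)])
  define m where "m = inv\<^bsub>PSL2R\<^esub> h \<otimes>\<^bsub>PSL2R\<^esub> k"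
  have m: "m \<in> carrier PSL2R" using h k by (simp add: m_def)
  have km: "\<delta> t = psl_act h (psl_act m (vline t))" for t
    using h(1) k by (simp add: m_def psl_act_mult)
  have "psl_act (dil l) (psl_act m (vline t)) = psl_act m (vline (t + s))" for t
  proof -
    have "psl_act h (psl_act (dil l) (psl_act m (vline t))) = psl_act g (\<delta> t)"
      unfolding km h(3) using h(1) m by (simp add: psl_act_mult)
    also have "\<dots> = psl_act h (psl_act m (vline (t + s)))"
      using g\<delta>[of t] \<open>e = 1\<close> by (simp add: km)
    finally show ?thesis
      by (rule inj_onD[OF inj_on_psl_act[OF h(1)]]) (use m in simp_all)
  qed
  then have "psl_act m (vline t) \<in> range vline" for t
    using dil_psl_invariant[OF m l] by blast
  then have "psl_act h (psl_act m (vline t)) \<in> psl_act h ` range vline" for t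
    by (rule imageI)
  then have "range \<delta> \<subseteq> range \<gamma>"
    unfolding h(2) by (auto simp: km image_image)
  then show ?thesis by (rule geodesic_line_range_eqI[OF \<delta>(1) \<gamma>])
qed

lemma axis_of_translates:
  assumes "g \<in> carrier PSL2R" "translates g \<gamma> l"
  shows "axis_of g = range \<gamma>"
  unfolding axis_of_def
proof (rule the_equality)
  show "(\<exists>\<gamma>'. geodesic_line \<gamma>' \<and> range \<gamma> = range \<gamma>') \<and> psl_act g ` range \<gamma> = range \<gamma>"
    using translates_range[OF assms(2)] assms(2) unfolding translates_def by blast
qed (use translates_invariant_unique[OF assms] in blast)

text \<open>This removes the definite description from \<open>ax\<close>; from here on an axis is
  handled through an element translating along it.\<close>

lemma ax_iff:
  assumes "\<Gamma> \<subseteq> carrier PSL2R"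
  shows "L \<in> ax \<Gamma> \<longleftrightarrow> (\<exists>g\<in>\<Gamma>. \<exists>\<gamma> l. translates g \<gamma> l \<and> L = range \<gamma>)"
proof
  assume "L \<in> ax \<Gamma>"
  then obtain g where g: "g \<in> \<Gamma>" "hyperbolic_element g" "L = axis_of g"
    by (auto simp: ax_def)
  obtain \<gamma> l where "translates g \<gamma> l" by (rule hyperbolic_element_translates[OF g(2)])
  then show "\<exists>g\<in>\<Gamma>. \<exists>\<gamma> l. translates g \<gamma> l \<and> L = range \<gamma>"
    using g assms axis_of_translates by blast
next
  assume "\<exists>g\<in>\<Gamma>. \<exists>\<gamma> l. translates g \<gamma> l \<and> L = range \<gamma>"
  then obtain g \<gamma> l where g: "g \<in> \<Gamma>" "translates g \<gamma> l" "L = range \<gamma>" by blast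
  then have "g \<in> carrier PSL2R" using assms by blast
  then have "L = axis_of g" "hyperbolic_element g"
    using g axis_of_translates translates_hyperbolic by blast+
  then show "L \<in> ax \<Gamma>"
    using g(1) unfolding ax_def by blast
qed


section \<open>Closed geodesics and cosets\<close>

lemma ax_psl_act:
  assumes \<Gamma>: "subgroup \<Gamma> PSL2R" and k: "k \<in> \<Gamma>" and L: "L \<in> ax \<Gamma>"
  shows "psl_act k ` L \<in> ax \<Gamma>"
proof -
  have sub: "\<Gamma> \<subseteq> carrier PSL2R" by (rule subgroup.subset[OF \<Gamma>])
  obtain g \<gamma> l where g: "g \<in> \<Gamma>" "translates g \<gamma> l" "L = range \<gamma>"
    using L unfolding ax_iff[OF sub] by blast
  have "translates (k \<otimes>\<^bsub>PSL2R\<^esub> g \<otimes>\<^bsub>PSL2R\<^esub> inv\<^bsub>PSL2R\<^esub> k) (\<lambda>t. psl_act k (\<gamma> t)) l"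
    by (rule translates_conj) (use g k sub in auto)
  moreover have "k \<otimes>\<^bsub>PSL2R\<^esub> g \<otimes>\<^bsub>PSL2R\<^esub> inv\<^bsub>PSL2R\<^esub> k \<in> \<Gamma>"
    using g k \<Gamma> by (simp add: subgroup.m_closed subgroup.m_inv_closed)
  moreover have "psl_act k ` L = range (\<lambda>t. psl_act k (\<gamma> t))"
    by (simp add: g(3) image_image)
  ultimately show ?thesis unfolding ax_iff[OF sub] by blast
qed

lemma ax_subset_uhp:
  assumes "\<Gamma> \<subseteq> carrier PSL2R" "L \<in> ax \<Gamma>"
  shows "L \<subseteq> uhp"
  using assms ax_iff[OF assms(1)] by (auto simp: translates_def)

lemma psl_act_mult_image:
  assumes "g \<in> carrier PSL2R" "h \<in> carrier PSL2R" "L \<subseteq> uhp"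
  shows "psl_act (g \<otimes>\<^bsub>PSL2R\<^esub> h) ` L = psl_act g ` psl_act h ` L"
  unfolding image_image using assms by (intro image_cong) (auto simp: psl_act_mult)

lemma psl_act_mult_ax:
  assumes "\<Gamma> \<subseteq> carrier PSL2R" "g \<in> carrier PSL2R" "h \<in> carrier PSL2R"
  shows "(\<lambda>L. psl_act (g \<otimes>\<^bsub>PSL2R\<^esub> h) ` L) ` ax \<Gamma> =
    (\<lambda>L. psl_act g ` L) ` (\<lambda>L. psl_act h ` L) ` ax \<Gamma>"
proof -
  have "(\<lambda>L. psl_act (g \<otimes>\<^bsub>PSL2R\<^esub> h) ` L) ` ax \<Gamma> = (\<lambda>L. psl_act g ` psl_act h ` L) ` ax \<Gamma>"
    using assms ax_subset_uhp[OF assms(1)] by (intro image_cong psl_act_mult_image) auto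
  then show ?thesis by (simp only: image_image)
qed

lemma subgroup_Aut_ax:
  assumes "\<Gamma> \<subseteq> carrier PSL2R"
  shows "subgroup (Aut_ax \<Gamma>) PSL2R"
proof (rule PSL2R.subgroupI)
  show "Aut_ax \<Gamma> \<noteq> {}"
    by (auto simp: Aut_ax_def intro!: exI[of _ "\<one>\<^bsub>PSL2R\<^esub>"])
next
  fix g assume "g \<in> Aut_ax \<Gamma>"
  then have g: "g \<in> carrier PSL2R" "(\<lambda>L. psl_act g ` L) ` ax \<Gamma> = ax \<Gamma>"
    by (auto simp: Aut_ax_def)
  have "(\<lambda>L. psl_act (inv\<^bsub>PSL2R\<^esub> g) ` L) ` ax \<Gamma> =
      (\<lambda>L. psl_act (inv\<^bsub>PSL2R\<^esub> g) ` L) ` (\<lambda>L. psl_act g ` L) ` ax \<Gamma>"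
    by (simp only: g(2))
  also have "\<dots> = ax \<Gamma>"
    using g(1) by (subst psl_act_mult_ax[OF assms, symmetric]) simp_all
  finally show "inv\<^bsub>PSL2R\<^esub> g \<in> Aut_ax \<Gamma>"
    using g(1) by (simp add: Aut_ax_def)
next
  fix g h assume "g \<in> Aut_ax \<Gamma>" "h \<in> Aut_ax \<Gamma>"
  then show "g \<otimes>\<^bsub>PSL2R\<^esub> h \<in> Aut_ax \<Gamma>"
    by (auto simp: Aut_ax_def psl_act_mult_ax[OF assms])
qed (auto simp: Aut_ax_def)

lemma subgroup_subset_Aut_ax:
  assumes "subgroup \<Gamma> PSL2R"
  shows "\<Gamma> \<subseteq> Aut_ax \<Gamma>"
proof
  fix k assume k: "k \<in> \<Gamma>"
  have sub: "\<Gamma> \<subseteq> carrier PSL2R" by (rule subgroup.subset[OF assms])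
  have "L \<in> (\<lambda>L. psl_act k ` L) ` ax \<Gamma>" if L: "L \<in> ax \<Gamma>" for L
  proof (rule image_eqI)
    show "psl_act (inv\<^bsub>PSL2R\<^esub> k) ` L \<in> ax \<Gamma>"
      using k L assms by (intro ax_psl_act) (auto simp: subgroup.m_inv_closed)
    show "L = psl_act k ` psl_act (inv\<^bsub>PSL2R\<^esub> k) ` L"
      using k sub ax_subset_uhp[OF sub L] by (subst psl_act_mult_image[symmetric]) auto
  qed
  then show "k \<in> Aut_ax \<Gamma>"
    using k sub ax_psl_act[OF assms k] by (auto simp: Aut_ax_def)
qed

text \<open>For each parameter \<open>t\<close> some element of \<open>\<Gamma>\<close> takes \<open>\<gamma> t\<close> to \<open>\<gamma> (t + l)\<close>. As \<open>\<Gamma>\<close> is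
  countable, two parameters share the same element, which then translates all of \<open>\<gamma>\<close>.\<close>

lemma closed_geodesic_translates:
  assumes \<Gamma>: "fuchsian \<Gamma>" and \<gamma>: "geodesic_line \<gamma>" and c: "closed_geodesic \<Gamma> (\<lambda>t. proj \<Gamma> (\<gamma> t)) l"
  obtains k where "k \<in> \<Gamma>" "translates k \<gamma> l"
proof -
  have sg: "subgroup \<Gamma> PSL2R" using \<Gamma> by (simp add: fuchsian_def)
  have l: "l > 0" and per: "\<And>t. proj \<Gamma> (\<gamma> (t + l)) = proj \<Gamma> (\<gamma> t)"
    using c by (auto simp: closed_geodesic_def)
  have "\<exists>k\<in>\<Gamma>. \<gamma> (t + l) = psl_act k (\<gamma> t)" for t
    using per[of t] proj_eq_iff[OF sg] \<gamma> by simp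
  then obtain k where k: "\<And>t. k t \<in> \<Gamma>" "\<And>t. \<gamma> (t + l) = psl_act (k t) (\<gamma> t)"
    by metis
  have "\<not> inj k"
  proof
    assume "inj k"
    moreover have "countable (range k)"
      by (rule countable_subset[OF _ fuchsian_countable[OF \<Gamma>]]) (use k in auto)
    ultimately show False
      using countable_image_inj_on uncountable_UNIV_real by blast
  qed
  then obtain a b where ab: "a \<noteq> b" "k a = k b" by (auto simp: inj_def)
  have ka: "k a \<in> carrier PSL2R" by (rule subgroup.mem_carrier[OF sg k(1)])
  have "(\<lambda>t. psl_act (k a) (\<gamma> t)) = (\<lambda>t. \<gamma> (1 * t + l))"
  proof (rule geodesic_line_eqI[OF geodesic_line_psl_act[OF ka \<gamma>] geodesic_line_reparam[OF \<gamma>] ab(1)])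
    show "psl_act (k a) (\<gamma> a) = \<gamma> (1 * a + l)" "psl_act (k a) (\<gamma> b) = \<gamma> (1 * b + l)"
      using k(2)[of a] k(2)[of b] by (simp, simp add: ab(2))
  qed simp
  then have "psl_act (k a) (\<gamma> t) = \<gamma> (t + l)" for t
    by (metis mult_1)
  then have "translates (k a) \<gamma> l"
    using \<gamma> l by (simp add: translates_def)
  with k(1) show thesis by (rule that)
qed

section \<open>Axes as the lifts of primitive closed geodesics\<close>

lemma translates_closed_geodesic:
  assumes \<Gamma>: "subgroup \<Gamma> PSL2R" and k: "k \<in> \<Gamma>" "translates k \<gamma> l"
  shows "closed_geodesic \<Gamma> (\<lambda>t. proj \<Gamma> (\<gamma> t)) \<bar>l\<bar>"
proof -
  have \<gamma>: "geodesic_line \<gamma>" and l: "l \<noteq> 0" using k by (auto simp: translates_def)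
  have k\<gamma>: "\<gamma> (t + l) = psl_act k (\<gamma> t)" for t using k(2) by (simp add: translates_def)
  have *: "proj \<Gamma> (\<gamma> (t + l)) = proj \<Gamma> (\<gamma> t)" for t
    unfolding proj_eq_iff[OF \<Gamma> geodesic_line_uhp[OF \<gamma>] geodesic_line_uhp[OF \<gamma>]]
    using k(1) k\<gamma> by blast
  have "proj \<Gamma> (\<gamma> (t + \<bar>l\<bar>)) = proj \<Gamma> (\<gamma> t)" for t
    using *[of t] *[of "t - l"] by (simp add: abs_if)
  with \<gamma> l show ?thesis by (auto simp: closed_geodesic_def)
qed

text \<open>Each admissible period \<open>l / n\<close> comes from an element of \<Gamma>
  translating \<gamma> by that amount. Distinct \<open>n\<close> give distinct elements, all
  displacing \<open>\<gamma> 0\<close> by at most \<open>l\<close>, so proper discontinuity allows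
  only finitely many \<open>n\<close>; the largest one gives a primitive period.\<close>

lemma closed_geodesic_primitive:
  assumes \<Gamma>: "fuchsian \<Gamma>" and c: "closed_geodesic \<Gamma> c l"
  obtains n :: nat where "primitive_closed_geodesic \<Gamma> c (l / real n)"
proof -
  obtain \<gamma> where \<gamma>: "geodesic_line \<gamma>" "c = (\<lambda>t. proj \<Gamma> (\<gamma> t))" and l: "l > 0"
    using c by (auto simp: closed_geodesic_def)
  define N where "N = {n::nat. n \<ge> 1 \<and> closed_geodesic \<Gamma> c (l / real n)}"
  have "\<exists>k\<in>\<Gamma>. translates k \<gamma> (l / real n)" if "n \<in> N" for n
    using that closed_geodesic_translates[OF \<Gamma> \<gamma>(1)] unfolding N_def \<gamma>(2) by blast
  then obtain k where k: "\<And>n. n \<in> N \<Longrightarrow> k n \<in> \<Gamma> \<and> translates (k n) \<gamma> (l / real n)"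
    by metis
  have k0: "psl_act (k n) (\<gamma> 0) = \<gamma> (l / real n)" if "n \<in> N" for n
    using k[OF that] by (auto simp: translates_def)
  have "inj_on k N"
  proof (rule inj_onI)
    fix m n assume mn: "m \<in> N" "n \<in> N" "k m = k n"
    then have "hdist (\<gamma> (l / real m)) (\<gamma> (l / real n)) = 0"
      using k0 by (metis hdist_self)
    then have "l / real m = l / real n" by (simp add: hdist_geodesic_line[OF \<gamma>(1)])
    then show "m = n" using mn l by (simp add: N_def field_simps)
  qed
  moreover have "k ` N \<subseteq> {g \<in> \<Gamma>. hdist (\<gamma> 0) (psl_act g (\<gamma> 0)) \<le> l}"
  proof (rule image_subsetI)
    fix n assume n: "n \<in> N"
    then have "\<bar>0 - l / real n\<bar> \<le> l" using l by (simp add: N_def field_simps)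
    then show "k n \<in> {g \<in> \<Gamma>. hdist (\<gamma> 0) (psl_act g (\<gamma> 0)) \<le> l}"
      using n k k0 by (simp add: hdist_geodesic_line[OF \<gamma>(1)])
  qed
  ultimately have fin: "finite N"
    using fuchsian_finite_displacement[OF \<Gamma>] \<gamma>(1)
    by (meson finite_imageD finite_subset geodesic_line_uhp)
  have "1 \<in> N" using c by (simp add: N_def)
  define n where "n = Max N"
  have n: "n \<in> N" unfolding n_def using fin \<open>1 \<in> N\<close> by (intro Max_in) auto
  have "\<not> closed_geodesic \<Gamma> c (l / real n / real m)" if "m \<ge> 2" for m
  proof
    assume "closed_geodesic \<Gamma> c (l / real n / real m)"
    then have "n * m \<in> N" using n that by (simp add: N_def)
    then have "n * m \<le> n" unfolding n_def using fin by simp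
    then show False using n that by (simp add: N_def)
  qed
  then have "primitive_closed_geodesic \<Gamma> c (l / real n)"
    using n by (auto simp: primitive_closed_geodesic_def N_def)
  then show thesis by (rule that)
qed

lemma parametrisations_refl: "c \<in> parametrisations c"
  unfolding parametrisations_def by (rule CollectI, rule exI[of _ 1], rule exI[of _ 0]) simp

lemma ax_primitive_closed_geodesic:
  assumes \<Gamma>: "fuchsian \<Gamma>" and \<gamma>: "geodesic_line \<gamma>" "range \<gamma> \<in> ax \<Gamma>"
  shows "parametrisations (\<lambda>t. proj \<Gamma> (\<gamma> t)) \<in> primitive_closed_geodesics \<Gamma>"
proof -
  have sg: "subgroup \<Gamma> PSL2R" using \<Gamma> by (simp add: fuchsian_def)
  obtain k \<delta> l where k: "k \<in> \<Gamma>" "translates k \<delta> l" "range \<gamma> = range \<delta>"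
    using \<gamma>(2) ax_iff[OF subgroup.subset[OF sg]] by blast
  then have "geodesic_line \<delta>" by (simp add: translates_def)
  with k(3) obtain e s where e: "\<bar>e\<bar> = 1" "\<gamma> = (\<lambda>t. \<delta> (e * t + s))"
    using geodesic_line_same_range[OF \<gamma>(1)] by blast
  have "translates k \<gamma> (e * l)"
    unfolding e(2) by (rule translates_reparam[OF k(2) e(1)])
  then show ?thesis
    using closed_geodesic_primitive[OF \<Gamma> translates_closed_geodesic[OF sg k(1)]]
    by (fastforce simp: primitive_closed_geodesics_def)
qed

text \<open>The converse passage to \<open>ax_primitive_closed_geodesic\<close>. Together they let
  an element of \<open>Aut_ax \<Gamma>\<close> act on lifts of primitive closed geodesics although
  it is known only to permute axes.\<close>

lemma primitive_closed_geodesic_lift: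
  assumes \<Gamma>: "fuchsian \<Gamma>" and \<alpha>: "\<alpha> \<in> primitive_closed_geodesics \<Gamma>"
    and \<gamma>: "geodesic_line \<gamma>" "(\<lambda>t. proj \<Gamma> (\<gamma> t)) \<in> \<alpha>"
  shows "range \<gamma> \<in> ax \<Gamma>"
proof -
  obtain c l where cl: "closed_geodesic \<Gamma> c l" and "\<alpha> = parametrisations c"
    using \<alpha> by (auto simp: primitive_closed_geodesics_def primitive_closed_geodesic_def)
  then obtain e s where e: "e = 1 \<or> e = -1" "(\<lambda>t. proj \<Gamma> (\<gamma> t)) = (\<lambda>t. c (e * t + s))"
    using \<gamma>(2) by (auto simp: parametrisations_def)
  have l: "l > 0" and per: "\<And>t. c (t + l) = c t"
    using cl by (auto simp: closed_geodesic_def)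
  have "c (e * (t + l) + s) = c (e * t + s)" for t
    using e(1) per[of "t + s"] per[of "- t - l + s"] by (auto simp: algebra_simps)
  then have "closed_geodesic \<Gamma> (\<lambda>t. proj \<Gamma> (\<gamma> t)) l"
    using l \<gamma>(1) by (simp add: closed_geodesic_def fun_cong[OF e(2)]) (use e(2) in metis)
  then obtain k where "k \<in> \<Gamma>" "translates k \<gamma> l"
    by (rule closed_geodesic_translates[OF \<Gamma> \<gamma>(1)])
  then show ?thesis
    using \<Gamma> ax_iff subgroup.subset unfolding fuchsian_def by blast
qed

lemma finite_cosets_same_projection:
  assumes \<Gamma>: "fuchsian \<Gamma>" and \<gamma>: "geodesic_line \<gamma>"
    and \<alpha>: "\<alpha> \<in> primitive_closed_geodesics \<Gamma>"
  shows "finite ((\<lambda>g. \<Gamma> #>\<^bsub>PSL2R\<^esub> g) `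
    {g \<in> carrier PSL2R. (\<lambda>t. proj \<Gamma> (psl_act g (\<gamma> t))) \<in> \<alpha> \<and> proj \<Gamma> (psl_act g (\<gamma> 0)) = z})"
    (is "finite (?C ` ?Q)")
proof (cases "?Q = {}")
  case True
  then show ?thesis by (simp only: image_empty finite.emptyI)
next
  case False
  have sg: "subgroup \<Gamma> PSL2R" using \<Gamma> by (simp add: fuchsian_def)
  have sub: "\<Gamma> \<subseteq> carrier PSL2R" by (rule subgroup.subset[OF sg])
  obtain h where h: "h \<in> carrier PSL2R" "proj \<Gamma> (psl_act h (\<gamma> 0)) = z"
    using False by blast
  \<comment> \<open>Any member of the set can supply the base point over \<open>z\<close>; all
    others are moved onto it by \<Gamma>.\<close>
  define w where "w = psl_act h (\<gamma> 0)"
  have w: "w \<in> uhp" "proj \<Gamma> w = z" using h \<gamma> by (simp_all add: w_def)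
  \<comment> \<open>The period belongs to \<alpha>, so it is fixed before \<open>g\<close> is
    chosen.\<close>
  obtain c l where cl: "closed_geodesic \<Gamma> c l" and \<alpha>c: "\<alpha> = parametrisations c"
    using \<alpha> by (auto simp: primitive_closed_geodesics_def primitive_closed_geodesic_def)
  have l: "l > 0" "\<And>t. c (t + l) = c t"
    using cl by (auto simp: closed_geodesic_def)
  define S where "S = (\<lambda>k. psl_act k w) ` {k \<in> \<Gamma>. hdist w (psl_act k w) \<le> l}"
  have "finite S"
    unfolding S_def by (intro finite_imageI fuchsian_finite_displacement[OF \<Gamma> w(1)])
  define T where "T = {g \<in> carrier PSL2R. psl_act g (\<gamma> 0) = w \<and> psl_act g (\<gamma> l) \<in> S}"
  have "inj_on (\<lambda>g. psl_act g (\<gamma> l)) T"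
    using l(1) by (intro inj_onI psl_act_eqI[OF _ _ \<gamma>, of _ _ 0 l]) (auto simp: T_def)
  moreover have "(\<lambda>g. psl_act g (\<gamma> l)) ` T \<subseteq> S" by (auto simp: T_def)
  ultimately have "finite T" using \<open>finite S\<close> by (meson finite_imageD finite_subset)
  moreover have "?C ` ?Q \<subseteq> ?C ` T"
  proof (rule image_subsetI)
    fix g assume "g \<in> ?Q"
    then have g: "g \<in> carrier PSL2R" "(\<lambda>t. proj \<Gamma> (psl_act g (\<gamma> t))) \<in> \<alpha>"
      "proj \<Gamma> (psl_act g (\<gamma> 0)) = z" by auto
    have "proj \<Gamma> w = proj \<Gamma> (psl_act g (\<gamma> 0))" using g(3) w(2) by simp
    then obtain k where k: "k \<in> \<Gamma>" "w = psl_act k (psl_act g (\<gamma> 0))"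
      using proj_eq_iff[OF sg w(1)] g(1) \<gamma> by auto
    define g' where "g' = k \<otimes>\<^bsub>PSL2R\<^esub> g"
    have kc: "k \<in> carrier PSL2R" using k(1) sub by blast
    have g': "g' \<in> carrier PSL2R" using g(1) kc by (simp add: g'_def)
    have g'act: "psl_act g' (\<gamma> t) = psl_act k (psl_act g (\<gamma> t))" for t
      using g(1) kc \<gamma> by (simp add: g'_def psl_act_mult)
    obtain e s where e: "e = 1 \<or> e = -1" "\<And>t. proj \<Gamma> (psl_act g (\<gamma> t)) = c (e * t + s)"
      using g(2) unfolding \<alpha>c parametrisations_def by (auto simp: fun_eq_iff)
    have "proj \<Gamma> (psl_act g' (\<gamma> l)) = proj \<Gamma> (psl_act g (\<gamma> l))"
      using k(1) kc g(1) \<gamma> by (subst proj_eq_iff[OF sg]) (auto simp: g'act)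
    \<comment> \<open>The curve may run along \<open>c\<close> in either direction: at parameter
      \<open>l\<close> it is at \<open>c (s + l)\<close> or at \<open>c (s - l)\<close>, and both
      equal \<open>c s\<close>.\<close>
    also have "\<dots> = proj \<Gamma> (psl_act g (\<gamma> 0))"
      using e l(2)[of s] l(2)[of "s - l"] by (auto simp: add.commute)
    also have "\<dots> = proj \<Gamma> w" using g(3) w(2) by simp
    finally obtain k' where k': "k' \<in> \<Gamma>" "psl_act g' (\<gamma> l) = psl_act k' w"
      using proj_eq_iff[OF sg] g' w(1) \<gamma> by auto
    have g'0: "psl_act g' (\<gamma> 0) = w" using k(2) g'act by simp
    have "hdist w (psl_act g' (\<gamma> l)) = l"
      using g' \<gamma> l(1) by (simp add: hdist_geodesic_line flip: g'0)
    then have "g' \<in> T" using g' g'0 k' by (auto simp: T_def S_def)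
    moreover have "?C g = ?C g'"
    proof -
      have "\<Gamma> #>\<^bsub>PSL2R\<^esub> (k \<otimes>\<^bsub>PSL2R\<^esub> g) = (\<Gamma> #>\<^bsub>PSL2R\<^esub> k) #>\<^bsub>PSL2R\<^esub> g"
        using sub kc g(1) by (simp add: PSL2R.coset_mult_assoc)
      then show ?thesis
        using PSL2R.coset_join2[OF kc sg k(1)] by (simp add: g'_def)
    qed
    ultimately show "?C g \<in> ?C ` T" by blast
  qed
  ultimately show ?thesis by (meson finite_imageI finite_subset)
qed

theorem lemma1p2p1:
  fixes \<Gamma> :: "(real^2^2) set set"
  assumes "fuchsian \<Gamma>"
    and "closed_hyperbolic_surface \<Gamma>"
    and "\<exists>\<theta>\<in>angle_spectrum \<Gamma>. angle_multiplicity \<Gamma> \<theta> < \<infinity>"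
  shows "has_finite_index \<Gamma> (PSL2R\<lparr>carrier := Aut_ax \<Gamma>\<rparr>)"
proof -
  have sg: "subgroup \<Gamma> PSL2R" using assms(1) by (simp add: fuchsian_def)
  have sub: "\<Gamma> \<subseteq> carrier PSL2R" by (rule subgroup.subset[OF sg])
  obtain \<theta> where fin: "finite (intersections_at_angle \<Gamma> \<theta>)"
    and ne: "intersections_at_angle \<Gamma> \<theta> \<noteq> {}"
    using assms(3) by (auto simp: angle_spectrum_def angle_multiplicity_def split: if_splits)
  then obtain \<alpha> \<beta> z where \<alpha>: "\<alpha> \<in> primitive_closed_geodesics \<Gamma>"
    and \<beta>: "\<beta> \<in> primitive_closed_geodesics \<Gamma>" and meet: "meets_at_angle \<Gamma> \<alpha> \<beta> z \<theta>"
    by (auto simp: intersections_at_angle_def)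
  then obtain \<gamma> \<delta> where \<gamma>: "geodesic_line \<gamma>" "(\<lambda>t. proj \<Gamma> (\<gamma> t)) \<in> \<alpha>"
    and \<delta>: "geodesic_line \<delta>" "(\<lambda>t. proj \<Gamma> (\<delta> t)) \<in> \<beta>"
    and eq0: "\<gamma> 0 = \<delta> 0" and \<theta>: "0 < \<theta>" "\<theta> < pi"
    and deriv: "vector_derivative \<delta> (at 0) = cis \<theta> * vector_derivative \<gamma> (at 0)"
    unfolding meets_at_angle_def by blast
  define cls where "cls = (\<lambda>\<eta> g. parametrisations (\<lambda>t. proj \<Gamma> (psl_act g (\<eta> t))))"
  \<comment> \<open>\<open>F\<close> records the intersection to which \<open>g\<close> carries the
    chosen one. Its values turn out to lie in the finite set of intersections at angle \<theta>, so
    \<open>Aut_ax \<Gamma>\<close> splits into finitely many fibres.\<close>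
  define F where "F = (\<lambda>g. (cls \<gamma> g, cls \<delta> g, proj \<Gamma> (psl_act g (\<gamma> 0))))"
  have cls: "cls \<eta> g \<in> primitive_closed_geodesics \<Gamma>"
    if g: "g \<in> Aut_ax \<Gamma>" and \<eta>: "geodesic_line \<eta>" "range \<eta> \<in> ax \<Gamma>" for g \<eta>
  proof -
    have "psl_act g ` range \<eta> \<in> ax \<Gamma>" "g \<in> carrier PSL2R"
      using g \<eta>(2) unfolding Aut_ax_def by blast+
    then show ?thesis
      unfolding cls_def using \<eta>(1)
      by (intro ax_primitive_closed_geodesic[OF assms(1)] geodesic_line_psl_act)
        (simp_all add: image_image)
  qed
  have F: "F g \<in> intersections_at_angle \<Gamma> \<theta>" if g: "g \<in> Aut_ax \<Gamma>" for g
  proof -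
    have gc: "g \<in> carrier PSL2R" using g by (simp add: Aut_ax_def)
    have "meets_at_angle \<Gamma> (cls \<gamma> g) (cls \<delta> g) (proj \<Gamma> (psl_act g (\<gamma> 0))) \<theta>"
      unfolding meets_at_angle_def
    proof (intro conjI exI)
      show "geodesic_line (\<lambda>t. psl_act g (\<gamma> t))" "geodesic_line (\<lambda>t. psl_act g (\<delta> t))"
        using gc \<gamma>(1) \<delta>(1) by (simp_all add: geodesic_line_psl_act)
      show "vector_derivative (\<lambda>t. psl_act g (\<delta> t)) (at 0) =
          cis \<theta> * vector_derivative (\<lambda>t. psl_act g (\<gamma> t)) (at 0)"
        by (rule vector_derivative_psl_act_cmult[OF gc \<gamma>(1) \<delta>(1) eq0 deriv])
    qed (use \<theta> eq0 in \<open>simp_all add: cls_def parametrisations_refl\<close>)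
    moreover have "cls \<gamma> g \<in> primitive_closed_geodesics \<Gamma>"
      by (rule cls[OF g \<gamma>(1) primitive_closed_geodesic_lift[OF assms(1) \<alpha> \<gamma>]])
    moreover have "cls \<delta> g \<in> primitive_closed_geodesics \<Gamma>"
      by (rule cls[OF g \<delta>(1) primitive_closed_geodesic_lift[OF assms(1) \<beta> \<delta>]])
    ultimately show ?thesis by (simp add: intersections_at_angle_def F_def)
  qed
  \<comment> \<open>\<open>Q \<tau>\<close> contains the fibre of \<open>F\<close> over \<tau>. Its
    condition asks that the curve belong to the given class of parametrisations, the form in which
    the coset bound is available.\<close>
  define Q where "Q = (\<lambda>(\<alpha>', \<beta>' :: (real \<Rightarrow> complex set) set, z').
    {g \<in> carrier PSL2R. (\<lambda>t. proj \<Gamma> (psl_act g (\<gamma> t))) \<in> \<alpha>' \<and> proj \<Gamma> (psl_act g (\<gamma> 0)) = z'})"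
  have "(\<lambda>g. \<Gamma> #>\<^bsub>PSL2R\<^esub> g) ` Aut_ax \<Gamma> \<subseteq>
      (\<Union>\<tau>\<in>intersections_at_angle \<Gamma> \<theta>. (\<lambda>g. \<Gamma> #>\<^bsub>PSL2R\<^esub> g) ` Q \<tau>)"
  proof (rule image_subsetI)
    fix g assume g: "g \<in> Aut_ax \<Gamma>"
    then have "g \<in> Q (F g)"
      by (auto simp: Q_def F_def cls_def Aut_ax_def parametrisations_refl)
    with F[OF g] show "\<Gamma> #>\<^bsub>PSL2R\<^esub> g \<in> (\<Union>\<tau>\<in>intersections_at_angle \<Gamma> \<theta>. (\<lambda>g. \<Gamma> #>\<^bsub>PSL2R\<^esub> g) ` Q \<tau>)"
      by blast
  qed
  moreover have "finite (\<Union>\<tau>\<in>intersections_at_angle \<Gamma> \<theta>. (\<lambda>g. \<Gamma> #>\<^bsub>PSL2R\<^esub> g) ` Q \<tau>)"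
    using fin
  proof (rule finite_UN_I)
    fix \<tau> assume "\<tau> \<in> intersections_at_angle \<Gamma> \<theta>"
    then show "finite ((\<lambda>g. \<Gamma> #>\<^bsub>PSL2R\<^esub> g) ` Q \<tau>)"
      using finite_cosets_same_projection[OF assms(1) \<gamma>(1)]
      by (cases \<tau>) (simp add: Q_def intersections_at_angle_def)
  qed
  ultimately have "finite ((\<lambda>g. \<Gamma> #>\<^bsub>PSL2R\<^esub> g) ` Aut_ax \<Gamma>)"
    by (rule finite_subset)
  moreover have "rcosets\<^bsub>PSL2R\<lparr>carrier := Aut_ax \<Gamma>\<rparr>\<^esub> \<Gamma> = (\<lambda>g. \<Gamma> #>\<^bsub>PSL2R\<^esub> g) ` Aut_ax \<Gamma>"
    by (auto simp: RCOSETS_def r_coset_def)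
  moreover have "subgroup \<Gamma> (PSL2R\<lparr>carrier := Aut_ax \<Gamma>\<rparr>)"
    by (rule PSL2R.subgroup_incl[OF sg subgroup_Aut_ax[OF sub] subgroup_subset_Aut_ax[OF sg]])
  ultimately show ?thesis by (simp add: has_finite_index_def)
qed

end
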